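(* Let $T>0$, let $c>0$ and $a>0$ be constants with $a<\left(\frac{\pi}{T}\right)^{2}+\frac{c^{2}}{4}$, and let $h:\mathbb{R}\to\mathbb{R}$ be a continuous, positive, $T$-periodic function. Consider the periodic problem $$x''+cx'+ax-x^{3}=h(t),\qquad x(0)=x(T),\quad x'(0)=x'(T).$$ Let $h_{0}:=\sqrt{4a^{3}/27}$. Then: (1) if $h(t)>h_{0}$ for all $t\in\mathbb{R}$, the problem has a unique $T$-periodic solution; this solution is negative (i.e. $x(t)<0$ for all $t$) and unstable; (2) if $0<h(t)<h_{0}$ for all $t\in\mathbb{R}$, the problem has exactly three $T$-periodic solutions, and they are ordered, $x_1(t)<x_2(t)<x_3(t)$ for all $t$; (3) moreover, in case (2), the minimal solution $x_1$ is negative and the other two $x_2,x_3$ are positive; the middle solution $x_2$ is asymptotically stable and $x_1$, $x_3$ are unstable.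
   Context: A $T$-periodic solution is called asymptotically stable or unstable in the Lyapunov sense, as a solution of the planar system $x'=y$, $y'=-cy-ax+x^3+h(t)$. Concretely, if $\mu_1,\mu_2$ are the eigenvalues (Floquet multipliers) of the monodromy matrix $M(T)$ of the linearized equation $y''+cy'+(a-3x(t)^2)y=0$ (with $M(0)=I$), the solution is asymptotically stable iff $|\mu_1|,|\mu_2|<1$, and unstable if some $|\mu_i|>1$. *)

theory Defs
  imports "HOL-Analysis.Analysis"
begin

definition periodic_solution ::
  "real \<Rightarrow> real \<Rightarrow> real \<Rightarrow> (real \<Rightarrow> real) \<Rightarrow> (real \<Rightarrow> real) \<Rightarrow> bool" where
  "periodic_solution T c a h x \<longleftrightarrow>
     (\<exists>y. (\<forall>t. (x has_real_derivative y t) (at t)) \<and>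
          (\<forall>t. (y has_real_derivative (- c * y t - a * x t + (x t)^3 + h t)) (at t)) \<and>
          (\<forall>t. x (t + T) = x t))"

definition lin_sol ::
  "real \<Rightarrow> real \<Rightarrow> (real \<Rightarrow> real) \<Rightarrow> (real \<Rightarrow> real) \<times> (real \<Rightarrow> real) \<Rightarrow> bool" where
  "lin_sol c a x uv \<longleftrightarrow>
     (\<forall>t. (fst uv has_real_derivative snd uv t) (at t)) \<and>
     (\<forall>t. (snd uv has_real_derivative (- c * snd uv t - (a - 3 * (x t)^2) * fst uv t)) (at t))"

definition fund1 :: "real \<Rightarrow> real \<Rightarrow> (real \<Rightarrow> real) \<Rightarrow> (real \<Rightarrow> real) \<times> (real \<Rightarrow> real)" where
  "fund1 c a x = (THE uv. lin_sol c a x uv \<and> fst uv 0 = 1 \<and> snd uv 0 = 0)"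

definition fund2 :: "real \<Rightarrow> real \<Rightarrow> (real \<Rightarrow> real) \<Rightarrow> (real \<Rightarrow> real) \<times> (real \<Rightarrow> real)" where
  "fund2 c a x = (THE uv. lin_sol c a x uv \<and> fst uv 0 = 0 \<and> snd uv 0 = 1)"

definition monodromy :: "real \<Rightarrow> real \<Rightarrow> real \<Rightarrow> (real \<Rightarrow> real) \<Rightarrow> real ^ 2 ^ 2" where
  "monodromy T c a x =
     (\<chi> i j. if i = 1 then (if j = 1 then fst (fund1 c a x) T else fst (fund2 c a x) T)
             else (if j = 1 then snd (fund1 c a x) T else snd (fund2 c a x) T))"

definition floquet_multipliers :: "real \<Rightarrow> real \<Rightarrow> real \<Rightarrow> (real \<Rightarrow> real) \<Rightarrow> complex set" where
  "floquet_multipliers T c a x =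
     (let M = monodromy T c a x in
      {\<mu>::complex. (\<mu> - complex_of_real (M $ 1 $ 1)) * (\<mu> - complex_of_real (M $ 2 $ 2))
                   - complex_of_real (M $ 1 $ 2) * complex_of_real (M $ 2 $ 1) = 0})"

definition asympt_stable :: "real \<Rightarrow> real \<Rightarrow> real \<Rightarrow> (real \<Rightarrow> real) \<Rightarrow> bool" where
  "asympt_stable T c a x \<longleftrightarrow> (\<forall>\<mu>\<in>floquet_multipliers T c a x. cmod \<mu> < 1)"

definition unstable :: "real \<Rightarrow> real \<Rightarrow> real \<Rightarrow> (real \<Rightarrow> real) \<Rightarrow> bool" where
  "unstable T c a x \<longleftrightarrow> (\<exists>\<mu>\<in>floquet_multipliers T c a x. cmod \<mu> > 1)"

end

theory Submission
  imports Defs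
begin

text \<open>
  Write the equation as \<open>x'' + c x' + f(x) = h\<close> with \<open>f(x) = a x - x\<^sup>3\<close>, and let \<open>m = sqrt (a / 3)\<close>
  be the point where \<open>f\<close> attains its positive local maximum \<open>h0 = 2 m\<^sup>3\<close>.

  Since \<open>a < (\<pi> / T)\<^sup>2 + c\<^sup>2 / 4\<close>, Sturm comparison with a sine shows that a \<open>T\<close>-periodic \<open>w\<close> with
  \<open>w'' + c w' + q w \<ge> 0\<close> and \<open>q \<le> a\<close> is nonpositive as soon as it has a zero. Hence every periodic
  solution has a strict sign and two distinct ones never touch. A negative solution stays below
  \<open>- sqrt a\<close>, where \<open>f\<close> is decreasing, so it is unique by the maximum principle. Three ordered
  positive solutions are excluded by looking at a maximum of the quotient of consecutive differences,
  as \<open>f\<close> is strictly concave on the positive axis.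

  For a constant \<open>k \<noteq> 0\<close> with \<open>k < (\<pi> / T)\<^sup>2 + c\<^sup>2 / 4\<close> the operator \<open>w'' + c w' + k w\<close> is invertible on periodic
  functions; its inverse has the sign of \<open>k\<close> and maps \<open>1\<close> to \<open>1 / k\<close>, so its sup norm is \<open>1 / \<bar>k\<bar>\<close>.
  Solutions are therefore fixed points of contractions on the order intervals \<open>[-B, - sqrt a]\<close>
  (\<open>k = - 3 B\<^sup>2\<close>), \<open>[0, r]\<close> with \<open>r < m\<close> (\<open>k = a\<close>) and \<open>[r', sqrt a]\<close> with \<open>r' > m\<close> (\<open>k = - 2 a\<close>).

  The monodromy matrix has determinant \<open>exp (- c T) < 1\<close>. Where \<open>f' < 0\<close> along the solution, its trace
  exceeds \<open>1 + exp (- c T)\<close>, which yields a real multiplier above 1. Where \<open>f' > 0\<close>, Sturm comparison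
  excludes real multipliers \<open>\<le> 0\<close>, and the minimum principle for the periodic part of a Floquet solution
  excludes real multipliers \<open>\<ge> 1\<close>; nonreal ones have modulus \<open>exp (- c T / 2)\<close>.
\<close>

section \<open>Primitives on the real line\<close>

text \<open>For either sign of \<open>t\<close> one of the two intervals is empty or a single point
  and contributes 0, so the difference is the oriented integral from 0 to \<open>t\<close>.\<close>

definition primitive :: "(real \<Rightarrow> 'a::banach) \<Rightarrow> real \<Rightarrow> 'a" where
  "primitive g t = integral {0..t} g - integral {t..0} g"

lemma primitive_0 [simp]: "primitive g 0 = 0"
  by (simp add: primitive_def)

lemma primitive_has_vector_derivative:
  fixes g :: "real \<Rightarrow> 'a::banach"
  assumes "continuous_on UNIV g"
  shows "(primitive g has_vector_derivative g t) (at t)"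
proof -
  define R where "R = \<bar>t\<bar> + 1"
  have R: "- R < t" "t < R" "R > 0" by (auto simp: R_def)
  have cont: "continuous_on S g" for S using assms continuous_on_subset by blast
  have int: "g integrable_on {u..v}" for u v
    by (rule integrable_continuous_real[OF cont])
  \<comment> \<open>Around \<open>t\<close> the two-sided formula differs by a constant from the
    integral with fixed left end \<open>-R\<close>, also across 0, so the fundamental theorem of
    calculus applies.\<close>
  have eq: "primitive g s = integral {-R..s} g - integral {-R..0} g" if "s \<in> {-R<..<R}" for s
  proof (cases "s \<ge> 0")
    case True
    then have "integral {-R..0} g + integral {0..s} g = integral {-R..s} g"
      using R by (intro Henstock_Kurzweil_Integration.integral_combine int) auto
    moreover have "integral {s..0} g = 0" using True by (cases "s = 0") auto
    ultimately show ?thesis by (simp add: primitive_def algebra_simps)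
  next
    case False
    then have "integral {-R..s} g + integral {s..0} g = integral {-R..0} g"
      using that by (intro Henstock_Kurzweil_Integration.integral_combine int) auto
    then show ?thesis using False by (simp add: primitive_def algebra_simps)
  qed
  have "((\<lambda>s. integral {-R..s} g) has_vector_derivative g t) (at t within {-R..R})"
    using R by (intro integral_has_vector_derivative cont) auto
  then have "((\<lambda>s. integral {-R..s} g) has_vector_derivative g t) (at t)"
    using R by (subst (asm) at_within_interior) auto
  then have "((\<lambda>s. integral {-R..s} g - integral {-R..0} g) has_vector_derivative g t) (at t)"
    by (auto intro!: derivative_eq_intros)
  then show ?thesis
    by (rule has_vector_derivative_transform_within_open[of _ _ _ "{-R<..<R}"]) (use R eq in auto)
qed

lemma primitive_has_real_derivative:
  assumes "continuous_on UNIV g"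
  shows "(primitive g has_real_derivative g t) (at t)"
  using primitive_has_vector_derivative[OF assms]
  by (simp add: has_real_derivative_iff_has_vector_derivative)

lemma continuous_on_primitive:
  fixes g :: "real \<Rightarrow> real"
  assumes "continuous_on UNIV g"
  shows "continuous_on A (primitive g)"
  by (meson DERIV_isCont assms continuous_at_imp_continuous_on primitive_has_real_derivative)

lemma continuous_on_if_has_real_derivative:
  assumes "\<forall>t. (f has_real_derivative f' t) (at t)"
  shows "continuous_on A f"
  by (meson DERIV_isCont assms continuous_at_imp_continuous_on)

text \<open>In the norm weighted by \<open>exp (K * \<bar>t\<bar>)\<close> integration gains a
  factor \<open>1 / K\<close>. This is what makes the Picard operator below a contraction on the
  whole line at once.\<close>

lemma primitive_bound:
  fixes g :: "real \<Rightarrow> real"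
  assumes cont: "continuous_on UNIV g" and K: "K > 0"
    and bd: "\<And>s. \<bar>g s\<bar> \<le> B * exp (K * \<bar>s\<bar>)"
  shows "\<bar>primitive g t\<bar> \<le> B / K * exp (K * \<bar>t\<bar>)"
proof -
  have B: "B \<ge> 0" using bd[of 0] by simp
  \<comment> \<open>Both \<open>G\<close> and \<open>- G\<close> grow no faster than
    \<open>B / K * exp (K * s)\<close> and start no higher. Negative times are reduced to this by
    reflection.\<close>
  have fwd: "\<bar>G t\<bar> \<le> B / K * exp (K * t)"
    if G: "\<And>s. (G has_real_derivative d s) (at s)" "G 0 = 0" 
      and d: "\<And>s. s \<ge> 0 \<Longrightarrow> \<bar>d s\<bar> \<le> B * exp (K * s)" and t: "t \<ge> 0" for G d t
  proof -
    have "(\<lambda>s. B / K * exp (K * s) - G s) 0 \<le> (\<lambda>s. B / K * exp (K * s) - G s) t"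
    proof (rule DERIV_nonneg_imp_nondecreasing[OF t])
      fix s assume s: "0 \<le> s" "s \<le> t"
      have "((\<lambda>s. B / K * exp (K * s) - G s) has_real_derivative B * exp (K * s) - d s) (at s)"
        using K by (auto intro!: derivative_eq_intros G)
      moreover have "B * exp (K * s) - d s \<ge> 0" using d[OF s(1)] by linarith
      ultimately show "\<exists>y. ((\<lambda>s. B / K * exp (K * s) - G s) has_real_derivative y) (at s) \<and> 0 \<le> y" by blast
    qed
    moreover have "(\<lambda>s. B / K * exp (K * s) + G s) 0 \<le> (\<lambda>s. B / K * exp (K * s) + G s) t"
    proof (rule DERIV_nonneg_imp_nondecreasing[OF t])
      fix s assume s: "0 \<le> s" "s \<le> t"
      have "((\<lambda>s. B / K * exp (K * s) + G s) has_real_derivative B * exp (K * s) + d s) (at s)"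
        using K by (auto intro!: derivative_eq_intros G)
      moreover have "B * exp (K * s) + d s \<ge> 0" using d[OF s(1)] by linarith
      ultimately show "\<exists>y. ((\<lambda>s. B / K * exp (K * s) + G s) has_real_derivative y) (at s) \<and> 0 \<le> y" by blast
    qed
    moreover have "B / K \<ge> 0" using B K by simp
    ultimately show ?thesis using G(2) by simp
  qed
  show ?thesis
  proof (cases "t \<ge> 0")
    case True
    then show ?thesis
      using fwd[of "primitive g" g t] bd primitive_has_real_derivative[OF cont] by (metis abs_of_nonneg primitive_0)
  next
    case False
    have "((\<lambda>s. primitive g (- s)) has_real_derivative - g (- s)) (at s)" for s
      by (rule DERIV_cong[OF DERIV_chain2[OF primitive_has_real_derivative[OF cont]]])
        (auto intro!: derivative_eq_intros)
    moreover have "\<bar>- g (- s)\<bar> \<le> B * exp (K * s)" if "s \<ge> 0" for s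
      using bd[of "-s"] that by simp
    ultimately have "\<bar>primitive g (- (- t))\<bar> \<le> B / K * exp (K * (- t))"
      using False by (intro fwd[of "\<lambda>s. primitive g (- s)" "\<lambda>s. - g (- s)"]) auto
    then show ?thesis using False by simp
  qed
qed

section \<open>Damped linear equations of second order\<close>

text \<open>First-order form of \<open>x'' + c x' + q x = g\<close> with velocity \<open>y\<close>.
  With suitable \<open>q\<close> it covers the Duffing equation itself, differences of its solutions
  and its linearization, so one comparison theory serves all three.\<close>

definition damped ::
  "real \<Rightarrow> (real \<Rightarrow> real) \<Rightarrow> (real \<Rightarrow> real) \<Rightarrow> (real \<Rightarrow> real) \<Rightarrow> (real \<Rightarrow> real) \<Rightarrow> bool" where
  "damped c q g x y \<longleftrightarrow>
     (\<forall>t. (x has_real_derivative y t) (at t)) \<and>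
     (\<forall>t. (y has_real_derivative (g t - c * y t - q t * x t)) (at t))"

lemma dampedD:
  assumes "damped c q g x y"
  shows "(x has_real_derivative y t) (at t)"
    and "(y has_real_derivative (g t - c * y t - q t * x t)) (at t)"
  using assms by (auto simp: damped_def)

lemma damped_continuous:
  assumes "damped c q g x y"
  shows "continuous_on A x" "continuous_on A y"
  using continuous_on_if_has_real_derivative[of x y A]
    continuous_on_if_has_real_derivative[of y "\<lambda>t. g t - c * y t - q t * x t" A] dampedD[OF assms]
  by blast+

lemma damped_combine:
  assumes "damped c q g x y" "damped c q g' x' y'"
  shows "damped c q (\<lambda>t. \<alpha> * g t + \<beta> * g' t) (\<lambda>t. \<alpha> * x t + \<beta> * x' t) (\<lambda>t. \<alpha> * y t + \<beta> * y' t)"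
  using assms unfolding damped_def
  by (auto intro!: derivative_eq_intros simp: algebra_simps)

lemma damped_shift:
  assumes "damped c q g x y"
  shows "damped c (\<lambda>t. q (t + T)) (\<lambda>t. g (t + T)) (\<lambda>t. x (t + T)) (\<lambda>t. y (t + T))"
  using assms unfolding damped_def
  by (auto simp: DERIV_shift[symmetric])

lemma damped_uminus:
  assumes "damped c q g x y"
  shows "damped c q (\<lambda>t. - g t) (\<lambda>t. - x t) (\<lambda>t. - y t)"
  using damped_combine[OF assms assms, of "-1" 0] by simp

section \<open>Uniqueness and global existence for the linear Cauchy problem\<close>

lemma damped_zero_unique:
  assumes D: "damped c q (\<lambda>_. 0) u v" and q: "\<And>t. \<bar>q t\<bar> \<le> Q"
    and zero: "u t0 = 0" "v t0 = 0"
  shows "u t = 0 \<and> v t = 0"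
proof -
  define E where "E t = (u t)\<^sup>2 + (v t)\<^sup>2" for t
  define E' where "E' t = 2 * u t * v t + 2 * v t * (- c * v t - q t * u t)" for t
  \<comment> \<open>The three summands bound the three terms of \<open>E'\<close>, which gives
    \<open>\<bar>E'\<bar> \<le> K * E\<close>. Gronwall's argument then makes \<open>E\<close>
    vanish forward and backward from \<open>t0\<close>.\<close>
  define K where "K = 1 + 2 * \<bar>c\<bar> + Q"
  have dE: "(E has_real_derivative E' t) (at t)" for t
    unfolding E_def E'_def
    by (auto intro!: derivative_eq_intros dampedD[OF D])
  have bd: "\<bar>E' t\<bar> \<le> K * E t" for t
  proof -
    have uv: "2 * \<bar>u t * v t\<bar> \<le> E t"
      using sum_squares_bound[of "\<bar>u t\<bar>" "\<bar>v t\<bar>"] by (simp add: E_def abs_mult)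
    have "\<bar>E' t\<bar> = \<bar>2 * (u t * v t) - 2 * c * (v t)\<^sup>2 - q t * (2 * (u t * v t))\<bar>"
      by (simp add: E'_def algebra_simps power2_eq_square)
    also have "\<dots> \<le> 2 * \<bar>u t * v t\<bar> + 2 * \<bar>c\<bar> * (v t)\<^sup>2 + \<bar>q t\<bar> * (2 * \<bar>u t * v t\<bar>)"
      by (rule order_trans[OF abs_triangle_ineq4] add_mono)+ (auto simp: abs_mult)
    also have "\<dots> \<le> E t + 2 * \<bar>c\<bar> * E t + Q * E t"
      using uv q[of t] by (intro add_mono mult_left_mono mult_mono) (auto simp: E_def)
    finally show ?thesis by (simp add: K_def algebra_simps)
  qed
  have E0: "E t0 = 0" by (simp add: E_def zero)
  have "E t \<le> 0"
  proof (cases "t \<ge> t0")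
    case True
    have "(\<lambda>s. exp (- K * s) * E s) t \<le> (\<lambda>s. exp (- K * s) * E s) t0"
    proof (rule DERIV_nonpos_imp_nonincreasing[OF True])
      fix s
      have "((\<lambda>s. exp (- K * s) * E s) has_real_derivative exp (- K * s) * (E' s - K * E s)) (at s)"
        by (auto intro!: derivative_eq_intros dE simp: algebra_simps)
      moreover have "exp (- K * s) * (E' s - K * E s) \<le> 0"
        using bd[of s] by (intro mult_nonneg_nonpos) auto
      ultimately show "\<exists>y. ((\<lambda>s. exp (- K * s) * E s) has_real_derivative y) (at s) \<and> y \<le> 0" by blast
    qed
    then show "E t \<le> 0" by (simp add: E0 mult_le_0_iff)
  next
    case False
    then have le: "t \<le> t0" by simp
    have "(\<lambda>s. exp (K * s) * E s) t \<le> (\<lambda>s. exp (K * s) * E s) t0"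
    proof (rule DERIV_nonneg_imp_nondecreasing[OF le])
      fix s
      have "((\<lambda>s. exp (K * s) * E s) has_real_derivative exp (K * s) * (E' s + K * E s)) (at s)"
        by (auto intro!: derivative_eq_intros dE simp: algebra_simps)
      moreover have "exp (K * s) * (E' s + K * E s) \<ge> 0"
        using bd[of s] by (intro mult_nonneg_nonneg) auto
      ultimately show "\<exists>y. ((\<lambda>s. exp (K * s) * E s) has_real_derivative y) (at s) \<and> 0 \<le> y" by blast
    qed
    then show "E t \<le> 0" by (simp add: E0 mult_le_0_iff)
  qed
  then show ?thesis
    by (simp add: E_def sum_power2_le_zero_iff)
qed

text \<open>Picard's fixed point is sought for the weighted velocity \<open>v / w\<close> in the
  complete space of bounded continuous functions on the line; the position is then recovered by
  integration.\<close>

lemma damped_exists: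
  assumes cq: "continuous_on UNIV q" and Q: "\<And>t. \<bar>q t\<bar> \<le> Q"
  shows "\<exists>u v. damped c q (\<lambda>_. 0) u v \<and> u 0 = u0 \<and> v 0 = v0"
proof -
  \<comment> \<open>Larger than \<open>\<bar>c\<bar> + Q\<close>, so the contraction factor is below
    1, and at least 1, so one integration does not enlarge the weighted norm.\<close>
  define K where "K = \<bar>c\<bar> + Q + 1"
  have Q0: "Q \<ge> 0" using Q[of 0] by linarith
  have K: "K \<ge> 1" using Q0 by (simp add: K_def)
  define w where "w s = exp (K * \<bar>s\<bar>)" for s
  have w: "w s > 0" "w s \<ge> 1" for s using K by (auto simp: w_def)
  have cw: "continuous_on UNIV w" unfolding w_def by (intro continuous_intros)
  define U where "U \<psi> = primitive (\<lambda>s. w s * \<psi> s)" for \<psi>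
  define V where "V b \<psi> = primitive (\<lambda>s. - c * (w s * \<psi> s) - q s * (b + U \<psi> s))" for b \<psi>
  have cU: "continuous_on UNIV (U \<psi>)" if "continuous_on UNIV \<psi>" for \<psi>
    unfolding U_def by (intro continuous_on_primitive continuous_intros cw that)
  have cin: "continuous_on UNIV (\<lambda>s. - c * (w s * \<psi> s) - q s * (b + U \<psi> s))"
    if "continuous_on UNIV \<psi>" for \<psi> b
    by (intro continuous_intros cw cU that cq)
  have cV: "continuous_on UNIV (V b \<psi>)" if "continuous_on UNIV \<psi>" for \<psi> b
    unfolding V_def by (intro continuous_on_primitive cin that)
  have U_bd: "\<bar>U \<psi> s\<bar> \<le> N * w s" if "continuous_on UNIV \<psi>" "\<And>s. \<bar>\<psi> s\<bar> \<le> N" for \<psi> N s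
  proof -
    have N: "N \<ge> 0" using that(2)[of 0] by linarith
    have "\<bar>w s * \<psi> s\<bar> \<le> N * exp (K * \<bar>s\<bar>)" for s
      using that(2)[of s] w(1)[of s] by (simp add: abs_mult w_def)
    then have "\<bar>U \<psi> s\<bar> \<le> N / K * exp (K * \<bar>s\<bar>)"
      unfolding U_def using K by (intro primitive_bound continuous_intros cw that) auto
    also have "\<dots> \<le> N * w s" unfolding w_def
      using K N by (intro mult_right_mono) (auto simp: divide_le_eq mult_le_cancel_left1)
    finally show ?thesis .
  qed
  \<comment> \<open>The initial position \<open>b\<close> is kept variable: \<open>b = u0\<close>
    bounds an iterate, \<open>b = 0\<close> bounds the difference of two iterates.\<close>
  have V_bd: "\<bar>V b \<psi> s\<bar> \<le> (\<bar>c\<bar> * N + Q * (\<bar>b\<bar> + N)) / K * w s"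
    if "continuous_on UNIV \<psi>" "\<And>s. \<bar>\<psi> s\<bar> \<le> N" for \<psi> N b s
    unfolding V_def w_def
  proof (rule primitive_bound)
    show "continuous_on UNIV (\<lambda>s. - c * (exp (K * \<bar>s\<bar>) * \<psi> s) - q s * (b + U \<psi> s))"
      using cin[OF that(1)] unfolding w_def .
    fix s
    have "\<bar>- c * (w s * \<psi> s) - q s * (b + U \<psi> s)\<bar> \<le> \<bar>- c * (w s * \<psi> s)\<bar> + \<bar>q s * (b + U \<psi> s)\<bar>"
      by (rule abs_triangle_ineq4)
    also have "\<dots> = \<bar>c\<bar> * (w s * \<bar>\<psi> s\<bar>) + \<bar>q s\<bar> * \<bar>b + U \<psi> s\<bar>"
      using w(1)[of s] by (simp add: abs_mult)
    also have "\<dots> \<le> \<bar>c\<bar> * (w s * N) + Q * (\<bar>b\<bar> * w s + N * w s)"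
    proof (intro add_mono mult_left_mono mult_mono Q)
      have "\<bar>b\<bar> \<le> \<bar>b\<bar> * w s" using w(2)[of s] by (simp add: mult_le_cancel_left1)
      then show "\<bar>b + U \<psi> s\<bar> \<le> \<bar>b\<bar> * w s + N * w s" using U_bd[OF that, of s] by linarith
    qed (use w(1)[of s] Q0 that in \<open>auto intro: less_imp_le\<close>)
    finally show "\<bar>- c * (exp (K * \<bar>s\<bar>) * \<psi> s) - q s * (b + U \<psi> s)\<bar>
        \<le> (\<bar>c\<bar> * N + Q * (\<bar>b\<bar> + N)) * exp (K * \<bar>s\<bar>)"
      by (simp add: w_def algebra_simps)
  qed (use K in auto)
  define F where "F \<psi> t = (v0 + V u0 \<psi> t) / w t" for \<psi> t
  define \<Phi> :: "(real \<Rightarrow>\<^sub>C real) \<Rightarrow> (real \<Rightarrow>\<^sub>C real)" where "\<Phi> \<psi> = Bcontfun (F (apply_bcontfun \<psi>))" for \<psi>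
  have cb: "continuous_on UNIV (apply_bcontfun \<psi>)" for \<psi> :: "real \<Rightarrow>\<^sub>C real"
    by (rule continuous_on_apply_bcontfun)
  have nb: "\<bar>apply_bcontfun \<psi> s\<bar> \<le> norm \<psi>" for \<psi> :: "real \<Rightarrow>\<^sub>C real" and s
    using norm_bounded[of \<psi> s] by simp
  have F: "F (apply_bcontfun \<psi>) \<in> bcontfun" for \<psi>
  proof (rule bcontfun_normI)
    show "continuous_on UNIV (F (apply_bcontfun \<psi>))"
      unfolding F_def using w(1) by (intro continuous_intros cV cb cw) (auto simp: less_imp_neq[symmetric])
    fix t
    let ?C = "(\<bar>c\<bar> * norm \<psi> + Q * (\<bar>u0\<bar> + norm \<psi>)) / K"
    have "\<bar>v0\<bar> \<le> \<bar>v0\<bar> * w t" using w(2)[of t] by (simp add: mult_le_cancel_left1)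
    then have "\<bar>v0 + V u0 \<psi> t\<bar> \<le> (\<bar>v0\<bar> + ?C) * w t"
      using V_bd[OF cb nb, of u0 \<psi> t] unfolding distrib_right by linarith
    then show "norm (F (apply_bcontfun \<psi>) t) \<le> \<bar>v0\<bar> + ?C"
      using w(1)[of t] by (simp add: F_def divide_le_eq)
  qed
  have app: "apply_bcontfun (\<Phi> \<psi>) = F (apply_bcontfun \<psi>)" for \<psi>
    unfolding \<Phi>_def by (rule Bcontfun_inverse[OF F])
  have prim_diff: "primitive f t - primitive g t = primitive (\<lambda>s. f s - g s) t"
    if "continuous_on UNIV f" "continuous_on UNIV g" for f g :: "real \<Rightarrow> real" and t
    unfolding primitive_def
    using that[THEN continuous_on_subset[OF _ subset_UNIV], THEN integrable_continuous_real]
    by (simp add: Henstock_Kurzweil_Integration.integral_diff)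
  have contr: "dist (\<Phi> \<psi>) (\<Phi> \<phi>) \<le> (\<bar>c\<bar> + Q) / K * dist \<psi> \<phi>" for \<psi> \<phi>
  proof (rule dist_bound)
    fix t
    let ?d = "\<lambda>s. apply_bcontfun \<psi> s - apply_bcontfun \<phi> s"
    have d: "continuous_on UNIV ?d" "\<And>s. \<bar>?d s\<bar> \<le> dist \<psi> \<phi>"
      using dist_bounded[of \<psi> _ \<phi>] by (auto intro!: continuous_intros simp: dist_real_def)
    have Ud: "U \<psi> s - U \<phi> s = U ?d s" for s
      unfolding U_def by (subst prim_diff) (auto intro!: continuous_intros cw simp: algebra_simps)
    have "V u0 \<psi> t - V u0 \<phi> t = V 0 ?d t"
      unfolding V_def prim_diff[OF cin[OF cb] cin[OF cb]]
      by (simp add: Ud[symmetric] algebra_simps)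
    then have "\<bar>V u0 \<psi> t - V u0 \<phi> t\<bar> \<le> (\<bar>c\<bar> + Q) / K * dist \<psi> \<phi> * w t"
      using V_bd[OF d, of 0 t] by (simp add: algebra_simps)
    moreover have "F \<psi> t - F \<phi> t = (V u0 \<psi> t - V u0 \<phi> t) / w t"
      by (simp add: F_def diff_divide_distrib[symmetric])
    ultimately show "dist (apply_bcontfun (\<Phi> \<psi>) t) (apply_bcontfun (\<Phi> \<phi>) t) \<le> (\<bar>c\<bar> + Q) / K * dist \<psi> \<phi>"
      using w(1)[of t] by (simp add: app dist_real_def divide_le_eq)
  qed
  have "\<exists>!\<psi>. \<Phi> \<psi> = \<psi>"
    using contr K Q0 by (intro banach_fix_type[of "(\<bar>c\<bar> + Q) / K"]) (auto simp: K_def)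
  then obtain \<psi> where \<psi>: "\<Phi> \<psi> = \<psi>" by blast
  define v where "v t = w t * apply_bcontfun \<psi> t" for t
  define u where "u t = u0 + U \<psi> t" for t
  have "v t = v0 + V u0 \<psi> t" for t
    using fun_cong[OF app[of \<psi>], of t] w(1)[of t] by (simp add: v_def F_def \<psi>)
  then have v_eq: "v = (\<lambda>t. v0 + V u0 \<psi> t)" by auto
  have u_eq: "u = (\<lambda>t. u0 + U \<psi> t)" by (auto simp: u_def)
  have "(u has_real_derivative v t) (at t)" for t
    unfolding u_eq U_def v_def
    by (rule DERIV_cong[OF DERIV_add[OF DERIV_const primitive_has_real_derivative]])
      (auto intro!: continuous_intros cw)
  moreover have "((\<lambda>t. v0 + V u0 \<psi> t) has_real_derivative (0 - c * v t - q t * u t)) (at t)" for t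
    unfolding V_def
    by (rule DERIV_cong[OF DERIV_add[OF DERIV_const primitive_has_real_derivative[OF cin[OF cb]]]])
      (simp add: v_def u_def)
  ultimately have "damped c q (\<lambda>_. 0) u v" by (auto simp: damped_def v_eq[symmetric])
  moreover have "u 0 = u0" "v 0 = v0" by (simp_all add: u_eq v_eq U_def V_def)
  ultimately show ?thesis by blast
qed

section \<open>Periodic functions and extrema\<close>

lemma periodic_int:
  fixes f :: "real \<Rightarrow> 'a"
  assumes "\<forall>t. f (t + T) = f t"
  shows "f (t + of_int n * T) = f t"
proof (induction n rule: int_induct[where k = 0])
  case base
  show ?case by simp
next
  case (step1 i)
  have "f (t + of_int (i + 1) * T) = f ((t + of_int i * T) + T)" by (simp add: algebra_simps)
  then show ?case using step1 assms by simp
next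
  case (step2 i)
  have "f (t + of_int i * T) = f ((t + of_int (i - 1) * T) + T)" by (simp add: algebra_simps)
  then show ?case using step2 assms by simp
qed

lemma periodic_representative:
  fixes f :: "real \<Rightarrow> 'a"
  assumes "\<forall>t. f (t + T) = f t" "T > 0"
  obtains n where "t0 \<le> t + of_int n * T" "t + of_int n * T < t0 + T" "f (t + of_int n * T) = f t"
proof
  define n where "n = - \<lfloor>(t - t0) / T\<rfloor>"
  have "- real_of_int n \<le> (t - t0) / T" "(t - t0) / T < - real_of_int n + 1"
    unfolding n_def by linarith+
  then show "t0 \<le> t + of_int n * T" "t + of_int n * T < t0 + T"
    using assms(2) by (simp_all add: field_simps)
  show "f (t + of_int n * T) = f t" by (rule periodic_int[OF assms(1)])
qed

lemma periodic_attains_max: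
  fixes f :: "real \<Rightarrow> real"
  assumes "continuous_on UNIV f" "\<forall>t. f (t + T) = f t" "T > 0"
  obtains t0 where "\<And>t. f t \<le> f t0"
proof -
  have "compact (f ` {0..T})"
    using assms(1) by (intro compact_continuous_image continuous_on_subset[OF assms(1)]) auto
  then obtain t0 where t0: "t0 \<in> {0..T}" "\<forall>t\<in>{0..T}. f t \<le> f t0"
    using compact_attains_sup[of "f ` {0..T}"] assms(3) by fastforce
  have "f t \<le> f t0" for t
  proof -
    obtain n where "0 \<le> t + of_int n * T" "t + of_int n * T < 0 + T" "f (t + of_int n * T) = f t"
      by (rule periodic_representative[OF assms(2,3)])
    then show ?thesis using t0(2) by (metis add_0 atLeastAtMost_iff less_imp_le)
  qed
  then show thesis using that by blast
qed

lemma periodic_bounded: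
  fixes f :: "real \<Rightarrow> real"
  assumes "continuous_on UNIV f" "\<forall>t. f (t + T) = f t" "T > 0"
  obtains B where "\<And>t. \<bar>f t\<bar> \<le> B"
proof -
  obtain t0 where "\<And>t. \<bar>f t\<bar> \<le> \<bar>f t0\<bar>"
    by (rule periodic_attains_max[of "\<lambda>t. \<bar>f t\<bar>" T]) (use assms in \<open>auto intro!: continuous_intros\<close>)
  then show thesis using that by blast
qed

lemma second_derivative_at_max:
  assumes x: "\<And>t. (x has_real_derivative y t) (at t)"
    and y: "(y has_real_derivative d) (at t0)" and max: "\<And>t. x t \<le> x t0"
  shows "y t0 = 0" "d \<le> 0"
proof -
  show y0: "y t0 = 0"
    by (rule DERIV_local_max[OF x, of 1]) (use max in auto)
  show "d \<le> 0"
  proof (rule ccontr)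
    assume "\<not> d \<le> 0"
    then obtain e where e: "e > 0" "\<And>h. h > 0 \<Longrightarrow> h < e \<Longrightarrow> y t0 < y (t0 + h)"
      using DERIV_pos_inc_right[OF y] by auto
    have "x t0 < x (t0 + e / 2)"
    proof (rule DERIV_pos_imp_increasing_open[of t0 "t0 + e / 2" x])
      fix s assume "t0 < s" "s < t0 + e / 2"
      then have "y s > 0" using e(2)[of "s - t0"] e(1) y0 by simp
      then show "\<exists>y. (x has_real_derivative y) (at s) \<and> 0 < y" using x by blast
    qed (use e(1) in simp, meson DERIV_isCont continuous_at_imp_continuous_on x)
    then show False using max[of "t0 + e / 2"] by linarith
  qed
qed

text \<open>The maximum principle in pointwise form: at a maximum the damping term vanishes and the
  second derivative is nonpositive.\<close>

lemma damped_at_max: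
  assumes D: "damped c q g x y" and per: "\<forall>t. x (t + T) = x t" "T > 0"
  obtains t0 where "\<And>t. x t \<le> x t0" "g t0 \<le> q t0 * x t0"
proof -
  obtain t0 where t0: "\<And>t. x t \<le> x t0"
    using periodic_attains_max damped_continuous(1)[OF D] per by blast
  have "g t0 - c * y t0 - q t0 * x t0 \<le> 0" "y t0 = 0"
    using second_derivative_at_max[OF dampedD(1)[OF D] dampedD(2)[OF D, of t0] t0] by auto
  then show thesis using that[OF t0] by simp
qed

lemma damped_at_min:
  assumes D: "damped c q g x y" and per: "\<forall>t. x (t + T) = x t" "T > 0"
  obtains t0 where "\<And>t. x t0 \<le> x t" "q t0 * x t0 \<le> g t0"
  using damped_at_max[OF damped_uminus[OF D], of T] per by auto

section \<open>Sturm comparison\<close>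

text \<open>Sturm comparison: the Wronskian of \<open>exp (c t / 2) x(t)\<close> with the sine that vanishes at the
  end points would be strictly increasing, although it is zero at both ends.\<close>

lemma no_short_positive_arc:
  assumes D: "damped c q g x y" and g: "\<And>t. g t \<ge> 0"
    and q: "\<And>t. q t < (pi / T)\<^sup>2 + c\<^sup>2 / 4"
    and \<alpha>\<beta>: "\<alpha> < \<beta>" "\<beta> \<le> \<alpha> + T" "x \<alpha> = 0" "x \<beta> = 0"
    and pos: "\<And>t. \<alpha> < t \<Longrightarrow> t < \<beta> \<Longrightarrow> x t > 0"
  shows False
proof -
  define \<omega> where "\<omega> = pi / (\<beta> - \<alpha>)"
  \<comment> \<open>The factor \<open>exp (b * t)\<close> removes the damping and turns the
    potential \<open>q\<close> into \<open>q - b\<^sup>2\<close>; the sine has potential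
    \<open>\<omega>\<^sup>2\<close>. Their difference appears in \<open>W'\<close>.\<close>
  define b where "b = c / 2"
  have b: "c = 2 * b" "c\<^sup>2 / 4 = b\<^sup>2" by (simp_all add: b_def power2_eq_square)
  define E where "E t = exp (b * t)" for t
  define S where "S t = sin (\<omega> * (t - \<alpha>))" for t
  define C where "C t = cos (\<omega> * (t - \<alpha>))" for t
  define W where "W t = E t * ((y t + b * x t) * S t - x t * (\<omega> * C t))" for t
  define W' where "W' t = E t * (S t * (g t + (\<omega>\<^sup>2 + b\<^sup>2 - q t) * x t))" for t
  have dE: "(E has_real_derivative b * E t) (at t)" for t
    unfolding E_def by (auto intro!: derivative_eq_intros)
  have dS: "(S has_real_derivative \<omega> * C t) (at t)" for t
    unfolding S_def C_def by (auto intro!: derivative_eq_intros)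
  have dC: "(C has_real_derivative - \<omega> * S t) (at t)" for t
    unfolding S_def C_def by (auto intro!: derivative_eq_intros)
  have dW: "(W has_real_derivative W' t) (at t)" for t
  proof -
    have "(W has_real_derivative b * E t * ((y t + b * x t) * S t - x t * (\<omega> * C t)) +
        ((g t - c * y t - q t * x t + b * y t) * S t + \<omega> * C t * (y t + b * x t)
          - (y t * (\<omega> * C t) + \<omega> * (- \<omega> * S t) * x t)) * E t) (at t)"
      unfolding W_def by (intro DERIV_mult DERIV_add DERIV_diff DERIV_cmult dE dS dC dampedD[OF D])
    also have "b * E t * ((y t + b * x t) * S t - x t * (\<omega> * C t)) +
        ((g t - c * y t - q t * x t + b * y t) * S t + \<omega> * C t * (y t + b * x t)
          - (y t * (\<omega> * C t) + \<omega> * (- \<omega> * S t) * x t)) * E t = W' t"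
      unfolding W'_def b(1) by algebra
    finally show ?thesis .
  qed
  have end_points: "W \<alpha> = 0" "W \<beta> = 0"
    using \<alpha>\<beta> by (auto simp: W_def S_def \<omega>_def)
  obtain t where t: "\<alpha> < t" "t < \<beta>" "W \<beta> - W \<alpha> = (\<beta> - \<alpha>) * W' t"
    using MVT2[OF \<alpha>\<beta>(1), of W W'] dW by blast
  \<comment> \<open>The arc is no longer than \<open>T\<close>, so the comparison sine oscillates at
    least as fast as the one for a full period.\<close>
  have "(pi / T)\<^sup>2 \<le> \<omega>\<^sup>2"
    unfolding \<omega>_def using \<alpha>\<beta>(1,2) by (intro power_mono divide_left_mono) auto
  then have "(\<omega>\<^sup>2 + b\<^sup>2 - q t) * x t > 0"
    using q[of t] pos[OF t(1,2)] unfolding b(2) by (intro mult_pos_pos) auto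
  moreover have "S t > 0"
    unfolding S_def
  proof (rule sin_gt_zero)
    show "0 < \<omega> * (t - \<alpha>)" using t \<alpha>\<beta>(1) by (auto simp: \<omega>_def)
    show "\<omega> * (t - \<alpha>) < pi" using t \<alpha>\<beta>(1) by (auto simp: \<omega>_def field_simps)
  qed
  ultimately have "W' t > 0"
    unfolding W'_def E_def using g[of t] by (intro mult_pos_pos) auto
  then show False using t end_points \<alpha>\<beta>(1) by simp
qed

text \<open>A positive value would lie on a positive arc between the last zero before it and the
  first zero after it, of length at most \<open>T\<close>. Zeros at distance \<open>T\<close> arise
  both from periodic solutions and from Floquet solutions with
  \<open>u (t + T) = r * u t\<close>.\<close>

lemma damped_nonpos_between_zeros:
  assumes D: "damped c q g x y" and g: "\<And>t. g t \<ge> 0"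
    and q: "\<And>t. q t < (pi / T)\<^sup>2 + c\<^sup>2 / 4"
    and zeros: "x t0 = 0" "x (t0 + T) = 0" and t: "t0 \<le> t" "t \<le> t0 + T"
  shows "x t \<le> 0"
proof (rule ccontr)
  assume "\<not> x t \<le> 0"
  then have xt: "x t > 0" by simp
  have cont: "continuous_on A x" for A by (rule damped_continuous(1)[OF D])
  have closed: "closed {s\<in>{u..v}. x s = 0}" for u v
    by (rule continuous_closed_preimage_constant[OF cont closed_atLeastAtMost])
  have cpt: "compact {s\<in>{u..v}. x s = 0}" for u v
  proof -
    have "bounded {s\<in>{u..v}. x s = 0}" by (rule bounded_subset[of "{u..v}"]) auto
    then show ?thesis using closed by (simp only: compact_eq_bounded_closed)
  qed
  obtain \<alpha> where \<alpha>: "\<alpha> \<in> {s\<in>{t0..t}. x s = 0}" "\<forall>s\<in>{s\<in>{t0..t}. x s = 0}. s \<le> \<alpha>"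
    using compact_attains_sup[OF cpt[of t0 t]] zeros t by fastforce
  obtain \<beta> where \<beta>: "\<beta> \<in> {s\<in>{t..t0+T}. x s = 0}" "\<forall>s\<in>{s\<in>{t..t0+T}. x s = 0}. \<beta> \<le> s"
    using compact_attains_inf[OF cpt[of t "t0 + T"]] zeros t by fastforce
  have "\<alpha> < t" "t < \<beta>" using \<alpha>(1) \<beta>(1) xt by (auto simp: less_le)
  moreover have "x s > 0" if s: "\<alpha> < s" "s < \<beta>" for s
  proof (rule ccontr)
    assume n: "\<not> 0 < x s"
    show False
    proof (cases "s \<le> t")
      case True
      obtain r where "s \<le> r" "r \<le> t" "x r = 0"
        using IVT'[of x s 0 t] n xt True cont by auto
      then show False using \<alpha>(1) bspec[OF \<alpha>(2), of r] s by simp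
    next
      case False
      obtain r where "t \<le> r" "r \<le> s" "x r = 0"
        using IVT2'[of x s 0 t] n xt False cont by auto
      then show False using \<beta>(1) bspec[OF \<beta>(2), of r] s by simp
    qed
  qed
  ultimately show False
    using no_short_positive_arc[OF D g q, of \<alpha> \<beta>] \<alpha>(1) \<beta>(1) by auto
qed

lemma damped_periodic_nonpos:
  assumes D: "damped c q g x y" and g: "\<And>t. g t \<ge> 0"
    and q: "\<And>t. q t < (pi / T)\<^sup>2 + c\<^sup>2 / 4"
    and per: "\<forall>t. x (t + T) = x t" "T > 0" and "x t0 = 0"
  shows "x t \<le> 0"
proof -
  obtain n where "t0 \<le> t + of_int n * T" "t + of_int n * T < t0 + T" "x (t + of_int n * T) = x t"
    by (rule periodic_representative[OF per])
  then show ?thesis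
    using damped_nonpos_between_zeros[OF D g q, of t0 "t + of_int n * T"] assms(6) per(1)
    by auto
qed

lemma continuous_nonzero_sign:
  fixes x :: "real \<Rightarrow> real"
  assumes "continuous_on UNIV x" "\<And>t. x t \<noteq> 0"
  shows "(\<forall>t. x t > 0) \<or> (\<forall>t. x t < 0)"
proof (rule ccontr)
  assume "\<not> ?thesis"
  then obtain s t where "x s < 0" "x t > 0" using assms(2) by (metis linorder_less_linear)
  moreover have "connected (x ` UNIV)" using assms(1) by (rule connected_continuous_image) simp
  ultimately have "0 \<in> range x"
    by (meson connected_contains_Icc atLeastAtMost_iff less_imp_le rangeI subsetD)
  then show False using assms(2) by auto
qed

text \<open>A zero would be a maximum by the Sturm argument, but there the second derivative equals
  the positive forcing.\<close>

lemma damped_periodic_sign: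
  assumes D: "damped c q g x y" and g: "\<And>t. g t > 0"
    and q: "\<And>t. q t < (pi / T)\<^sup>2 + c\<^sup>2 / 4"
    and per: "\<forall>t. x (t + T) = x t" "T > 0"
  shows "(\<forall>t. x t > 0) \<or> (\<forall>t. x t < 0)"
proof (rule continuous_nonzero_sign[OF damped_continuous(1)[OF D]])
  fix t0
  show "x t0 \<noteq> 0"
  proof
    assume x0: "x t0 = 0"
    have max: "x t \<le> x t0" for t
      using damped_periodic_nonpos[OF D less_imp_le[OF g] q per x0] x0 by simp
    have "g t0 - c * y t0 - q t0 * x t0 \<le> 0" "y t0 = 0"
      using second_derivative_at_max[OF dampedD(1)[OF D] dampedD(2)[OF D, of t0] max] by auto
    then show False using g[of t0] x0 by simp
  qed
qed

lemma damped_periodic_zero: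
  assumes D: "damped c q (\<lambda>_. 0) x y"
    and q: "\<And>t. q t < (pi / T)\<^sup>2 + c\<^sup>2 / 4"
    and per: "\<forall>t. x (t + T) = x t" "T > 0" and "x t0 = 0"
  shows "x t = 0"
  using damped_periodic_nonpos[OF D _ q per, of t0 t]
    damped_periodic_nonpos[OF damped_uminus[OF D], of T t0 t] q per assms(5) by fastforce

text \<open>For \<open>k < 0\<close> this is the maximum principle. For \<open>k > 0\<close> the
  forcing is made strictly positive by adding \<open>e\<close>, which shifts the solution by
  \<open>e / k\<close>; the strict sign result applies, the maximum rules out the negative sign, and
  \<open>e\<close> tends to 0.\<close>

lemma damped_constant_comparison:
  assumes D: "damped c (\<lambda>_. k) g x y" and g: "\<And>t. g t \<ge> 0"
    and k: "k \<noteq> 0" "k < (pi / T)\<^sup>2 + c\<^sup>2 / 4"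
    and per: "\<forall>t. x (t + T) = x t" "T > 0"
  shows "k * x t \<ge> 0"
proof (cases "k > 0")
  case False
  then have "k < 0" using k by simp
  obtain t0 where "\<And>t. x t \<le> x t0" "g t0 \<le> k * x t0"
    using damped_at_max[OF D per] by blast
  then have "x t \<le> x t0" "x t0 \<le> 0" using g[of t0] \<open>k < 0\<close> by (auto simp: zero_le_mult_iff dest: order_trans)
  then show ?thesis using \<open>k < 0\<close> by (auto simp: zero_le_mult_iff)
next
  case True
  have "k * x t + e \<ge> 0" if e: "e > 0" for e
  proof -
    have D': "damped c (\<lambda>_. k) (\<lambda>t. g t + e) (\<lambda>t. x t + e / k) y"
      using D k unfolding damped_def by (auto intro!: derivative_eq_intros simp: algebra_simps)
    have per': "\<forall>t. x (t + T) + e / k = x t + e / k" using per by simp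
    have pos: "g t + e > 0" for t using g[of t] e by simp
    have "(\<forall>t. x t + e / k > 0) \<or> (\<forall>t. x t + e / k < 0)"
      using damped_periodic_sign[OF D' pos k(2) per' per(2)] .
    moreover have "\<not> (\<forall>t. x t + e / k < 0)"
    proof
      assume neg: "\<forall>t. x t + e / k < 0"
      obtain t0 where "g t0 + e \<le> k * (x t0 + e / k)"
        using damped_at_max[OF D' per' per(2)] by blast
      moreover have "k * (x t0 + e / k) < 0" using neg True by (simp add: mult_pos_neg)
      ultimately show False using pos[of t0] by linarith
    qed
    ultimately have "x t + e / k > 0" by blast
    then have "k * (x t + e / k) > 0" using True by simp
    then show ?thesis using True by (simp add: algebra_simps)
  qed
  then show ?thesis using field_le_epsilon[of 0 "k * x t"] by blast
qed

section \<open>Existence of periodic solutions\<close>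

text \<open>Variation of constants. Off the imaginary axis \<open>exp (\<rho> * T)\<close> differs
  from 1, so the free constant can be chosen to close the orbit.\<close>

lemma first_order_periodic_solution:
  fixes g :: "real \<Rightarrow> complex" and \<rho> :: complex
  assumes g: "continuous_on UNIV g" "\<forall>t. g (t + T) = g t" and T: "T > 0" and \<rho>: "Re \<rho> \<noteq> 0"
  obtains z where "\<And>t. (z has_vector_derivative \<rho> * z t + g t) (at t)" "\<forall>t. z (t + T) = z t"
proof -
  define e where "e t = exp (of_real t * \<rho>)" for t :: real
  have e: "(e has_vector_derivative \<rho> * e t) (at t)" for t
    unfolding e_def
    by (rule has_vector_derivative_eq_rhs[OF exp_scaleR_has_vector_derivative_left[unfolded scaleR_conv_of_real]]) simp
  define e' where "e' t = exp (- of_real t * \<rho>)" for t :: real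
  have e': "(e' has_vector_derivative - \<rho> * e' t) (at t)" for t
  proof -
    have "e' = (\<lambda>t. exp (t *\<^sub>R (- \<rho>)))" by (auto simp: e'_def scaleR_conv_of_real)
    then show ?thesis using exp_scaleR_has_vector_derivative_left[of "- \<rho>" t] by simp
  qed
  have ee': "e t * e' t = 1" for t by (simp add: e_def e'_def flip: exp_add)
  have "cmod (e T) \<noteq> 1" using T \<rho> by (simp add: e_def norm_exp_eq_Re)
  then have eT: "e T - 1 \<noteq> 0" by auto
  define G where "G = primitive (\<lambda>s. e' s * g s)"
  have cont: "continuous_on UNIV (\<lambda>s. e' s * g s)"
    unfolding e'_def by (intro continuous_intros g)
  have G: "(G has_vector_derivative e' t * g t) (at t)" for t
    unfolding G_def by (rule primitive_has_vector_derivative[OF cont])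
  \<comment> \<open>The solution of \<open>e T * (K + G T) = K\<close>, that is, of
    \<open>z T = z 0\<close>.\<close>
  define K where "K = - e T * G T / (e T - 1)"
  define z where "z t = e t * (K + G t)" for t
  have z: "(z has_vector_derivative \<rho> * z t + g t) (at t)" for t
    unfolding z_def
    by (rule has_vector_derivative_eq_rhs[OF has_vector_derivative_mult[OF e
            has_vector_derivative_add[OF has_vector_derivative_const G]]])
      (simp add: ee' flip: mult.assoc)
  have "G 0 = 0" "e 0 = 1" by (auto simp: G_def e_def)
  then have zT: "z T = z 0" using eT by (simp add: z_def K_def field_simps)
  have "z (t + T) = z t" for t
  proof -
    \<comment> \<open>The shifted and the original solution differ by a solution of the homogeneous
      equation; stripped of its exponential it is constant, and it is 0 at time 0.\<close>
    define d where "d s = e' s * (z (s + T) - z s)" for s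
    have zs: "((\<lambda>s. z (s + T)) has_vector_derivative \<rho> * z (s + T) + g s) (at s)" for s
    proof -
      have "((\<lambda>s. s + T) has_vector_derivative 1) (at s)"
        using has_vector_derivative_add[OF has_vector_derivative_id has_vector_derivative_const] by simp
      then have "(z \<circ> (\<lambda>s. s + T) has_vector_derivative 1 *\<^sub>R (\<rho> * z (s + T) + g (s + T))) (at s)"
        by (rule vector_diff_chain_at[OF _ z])
      then show ?thesis using g(2) by (simp add: o_def)
    qed
    have "(d has_vector_derivative 0) (at s)" for s
      unfolding d_def
      by (rule has_vector_derivative_eq_rhs[OF has_vector_derivative_mult[OF e'
              has_vector_derivative_diff[OF zs z]]])
         (simp add: algebra_simps)
    then obtain C where "\<And>s. s \<in> UNIV \<Longrightarrow> d s = C"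
      using has_vector_derivative_zero_constant[OF convex_UNIV, of d] by blast
    then have "d t = d 0" by simp
    then have "d t = 0" using zT by (simp add: d_def)
    then show ?thesis by (simp add: d_def e'_def)
  qed
  then show thesis using that z by blast
qed

text \<open>With \<open>D\<close> for differentiation, the operator factors over the complex numbers
  as \<open>(D - \<rho>1) (D - \<rho>2)\<close>. Two first-order equations are solved in turn and
  the real part is taken.\<close>

lemma damped_constant_periodic_solution:
  assumes g: "continuous_on UNIV g" "\<forall>t. g (t + T) = g t" and T: "T > 0" and c: "c > 0" and k: "k \<noteq> 0"
  obtains x y where "damped c (\<lambda>_. k) g x y" "\<forall>t. x (t + T) = x t"
proof -
  define s where "s = csqrt (of_real (c\<^sup>2 - 4 * k))"
  define \<rho>1 where "\<rho>1 = (- of_real c + s) / 2"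
  define \<rho>2 where "\<rho>2 = (- of_real c - s) / 2"
  have s2: "s\<^sup>2 = of_real (c\<^sup>2 - 4 * k)" by (simp add: s_def)
  have sum: "\<rho>1 + \<rho>2 = - of_real c" by (simp add: \<rho>1_def \<rho>2_def field_simps)
  have c_eq: "of_real c = - (\<rho>1 + \<rho>2)" by (simp add: sum)
  have prod: "\<rho>1 * \<rho>2 = of_real k"
    using s2 by (simp add: \<rho>1_def \<rho>2_def field_simps power2_eq_square)
  \<comment> \<open>On the imaginary axis the product has imaginary part
    \<open>- c * Im \<mu>\<close>; since it is real, \<open>\<mu>\<close> would be 0, against
    \<open>k \<noteq> 0\<close>.\<close>
  have re: "Re \<mu> \<noteq> 0" if "\<mu> + \<nu> = - of_real c" "\<mu> * \<nu> = of_real k" for \<mu> \<nu> :: complex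
  proof
    assume r: "Re \<mu> = 0"
    have "\<nu> = - of_real c - \<mu>" using that(1) by (simp add: algebra_simps eq_neg_iff_add_eq_0)
    then have "Re (\<mu> * (- of_real c - \<mu>)) = k" "Im (\<mu> * (- of_real c - \<mu>)) = 0" using that(2) by auto
    then show False using r c k by (auto simp: power2_eq_square)
  qed
  have re1: "Re \<rho>1 \<noteq> 0" and re2: "Re \<rho>2 \<noteq> 0"
    using re[OF sum prod] re[of \<rho>2 \<rho>1] sum prod by (simp_all add: add.commute mult.commute)
  obtain z where z: "\<And>t. (z has_vector_derivative \<rho>1 * z t + of_real (g t)) (at t)" "\<forall>t. z (t + T) = z t"
    by (rule first_order_periodic_solution[of "\<lambda>t. of_real (g t)" T \<rho>1])
      (use g T re1 in \<open>auto intro!: continuous_intros\<close>)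
  have "continuous_on UNIV z"
    using z(1) by (meson continuous_at_imp_continuous_on has_vector_derivative_continuous)
  then obtain w where w: "\<And>t. (w has_vector_derivative \<rho>2 * w t + z t) (at t)" "\<forall>t. w (t + T) = w t"
    using first_order_periodic_solution[of z T \<rho>2] z(2) T re2 by metis
  define y where "y t = \<rho>2 * w t + z t" for t
  have y: "(y has_vector_derivative of_real (g t) - of_real c * y t - of_real k * w t) (at t)" for t
    unfolding y_def
    by (rule has_vector_derivative_eq_rhs[OF has_vector_derivative_add[OF
            has_vector_derivative_mult_right[OF w(1)] z(1)]])
       (simp add: prod[symmetric] c_eq algebra_simps)
  have Re: "((\<lambda>t. Re (f t)) has_real_derivative Re f') (at t)" if "(f has_vector_derivative f') (at t)" for f f' t
    using bounded_linear.has_vector_derivative[OF bounded_linear_Re that]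
    by (simp add: has_real_derivative_iff_has_vector_derivative)
  have "damped c (\<lambda>_. k) g (\<lambda>t. Re (w t)) (\<lambda>t. Re (y t))"
    using Re[OF w(1)] Re[OF y] unfolding damped_def y_def[symmetric] by simp
  then show thesis using that w(2) by simp
qed

text \<open>The constant \<open>p\<close> solves the equation with forcing \<open>k * p\<close>, so
  the comparison applies to \<open>x - p\<close>. With the matching upper bound this says that the
  periodic inverse has sup norm at most \<open>1 / \<bar>k\<bar>\<close>.\<close>

lemma damped_constant_lower_bound:
  assumes D: "damped c (\<lambda>_. k) g x y" and g: "\<And>t. p \<le> g t / k"
    and k: "k \<noteq> 0" "k < (pi / T)\<^sup>2 + c\<^sup>2 / 4"
    and per: "\<forall>t. x (t + T) = x t" "T > 0"
  shows "p \<le> x t"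
proof -
  have D': "damped c (\<lambda>_. k) (\<lambda>t. g t - k * p) (\<lambda>t. x t - p) y"
    using D unfolding damped_def by (auto intro!: derivative_eq_intros simp: algebra_simps)
  show ?thesis
  proof (cases "k > 0")
    case True
    then have "0 \<le> g s - k * p" for s using g[of s] by (simp add: field_simps)
    then have "0 \<le> k * (x t - p)"
      using damped_constant_comparison[OF D' _ k _ per(2), of t] per(1) by simp
    then show ?thesis using True by (simp add: zero_le_mult_iff)
  next
    case False
    then have neg: "k < 0" using k by simp
    then have "0 \<le> - (g s - k * p)" for s using g[of s] by (simp add: field_simps)
    then have "0 \<le> k * - (x t - p)"
      using damped_constant_comparison[OF damped_uminus[OF D'] _ k _ per(2), of t] per(1) by simp
    then show ?thesis using neg by (simp add: mult_le_0_iff zero_le_mult_iff)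
  qed
qed

lemma damped_constant_upper_bound:
  assumes D: "damped c (\<lambda>_. k) g x y" and g: "\<And>t. g t / k \<le> p"
    and k: "k \<noteq> 0" "k < (pi / T)\<^sup>2 + c\<^sup>2 / 4"
    and per: "\<forall>t. x (t + T) = x t" "T > 0"
  shows "x t \<le> p"
  using damped_constant_lower_bound[OF damped_uminus[OF D] _ k _ per(2), of "- p" t] g per(1)
  by simp

section \<open>Nonlinear existence by contraction on order intervals\<close>

lemma continuous_on_eval_bcontfun: "continuous_on UNIV (\<lambda>\<psi>::real \<Rightarrow>\<^sub>C real. apply_bcontfun \<psi> t)"
  unfolding continuous_on_iff
  using dist_bounded order_le_less_trans by blast

text \<open>With \<open>\<phi> s = s - (a * s - s ^ 3) / k\<close> the equation reads
  \<open>x'' + c x' + k x = k * \<phi> x + h\<close>. As \<open>\<phi>\<close> increases on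
  \<open>[p, r]\<close>, the conditions at the two ends keep the order interval invariant; its slope
  is at most \<open>\<theta>\<close>, so inverting the left side gives a contraction.\<close>

lemma duffing_solution_between:
  assumes h: "continuous_on UNIV h" "\<forall>t. h (t + T) = h t" and T: "T > 0" and c: "c > 0"
    and k: "k \<noteq> 0" "k < (pi / T)\<^sup>2 + c\<^sup>2 / 4" and pr: "p \<le> r" and \<theta>: "\<theta> < 1"
    and der: "\<And>s. p \<le> s \<Longrightarrow> s \<le> r \<Longrightarrow> 0 \<le> 1 - (a - 3 * s\<^sup>2) / k \<and> 1 - (a - 3 * s\<^sup>2) / k \<le> \<theta>"
    and lo: "\<And>t. (a * p - p ^ 3 - h t) / k \<le> 0" and hi: "\<And>t. (a * r - r ^ 3 - h t) / k \<ge> 0"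
  obtains x where "periodic_solution T c a h x" "\<And>t. p \<le> x t" "\<And>t. x t \<le> r"
proof -
  define \<phi> where "\<phi> s = s - (a * s - s ^ 3) / k" for s
  have d\<phi>: "(\<phi> has_real_derivative 1 - (a - 3 * s\<^sup>2) / k) (at s)" for s
    unfolding \<phi>_def using k by (auto intro!: derivative_eq_intros simp: power2_eq_square)
  have mono: "0 \<le> \<phi> v - \<phi> u \<and> \<phi> v - \<phi> u \<le> \<theta> * (v - u)" if uv: "p \<le> u" "u \<le> v" "v \<le> r" for u v
  proof (cases "u = v")
    case False
    then have "u < v" using uv by simp
    then obtain s where s: "u < s" "s < v" "\<phi> v - \<phi> u = (v - u) * (1 - (a - 3 * s\<^sup>2) / k)"
      using MVT2[of u v \<phi> "\<lambda>s. 1 - (a - 3 * s\<^sup>2) / k"] d\<phi> by blast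
    have "0 \<le> 1 - (a - 3 * s\<^sup>2) / k" "1 - (a - 3 * s\<^sup>2) / k \<le> \<theta>"
      using der[of s] s uv by auto
    then show ?thesis using uv unfolding s(3)
      by (metis diff_ge_0_iff_ge mult.commute mult_left_mono mult_nonneg_nonneg)
  qed simp
  have lip: "\<bar>\<phi> v - \<phi> u\<bar> \<le> \<theta> * \<bar>v - u\<bar>" if "p \<le> u" "u \<le> r" "p \<le> v" "v \<le> r" for u v
    using mono[of u v] mono[of v u] that by (cases "u \<le> v") auto
  have \<theta>0: "\<theta> \<ge> 0" using der[of p] pr by linarith
  define X where "X = {\<psi>::real \<Rightarrow>\<^sub>C real. (\<forall>t. apply_bcontfun \<psi> (t + T) = apply_bcontfun \<psi> t) \<and>
      (\<forall>t. p \<le> apply_bcontfun \<psi> t) \<and> (\<forall>t. apply_bcontfun \<psi> t \<le> r)}"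
  have "closed X"
    unfolding X_def
    by (intro closed_Collect_conj closed_Collect_all closed_Collect_eq closed_Collect_le
        continuous_on_eval_bcontfun continuous_on_const)
  then have X_complete: "complete X" by (simp add: complete_eq_closed)
  have "(\<lambda>_::real. p) \<in> bcontfun" by (rule bcontfun_normI[of _ "\<bar>p\<bar>"]) auto
  then have "apply_bcontfun (Bcontfun (\<lambda>_::real. p)) = (\<lambda>_. p)" by (rule Bcontfun_inverse)
  then have "Bcontfun (\<lambda>_::real. p) \<in> X" using pr by (simp add: X_def)
  then have X_ne: "X \<noteq> {}" by auto
  define N where "N \<psi> t = k * \<phi> (apply_bcontfun \<psi> t) + h t" for \<psi> t
  define S where "S \<psi> x \<longleftrightarrow> (\<exists>y. damped c (\<lambda>_. k) (N \<psi>) x y) \<and> (\<forall>t. x (t + T) = x t)" for \<psi> x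
  have ex: "\<exists>x. S \<psi> x" if "\<psi> \<in> X" for \<psi>
  proof -
    have "continuous_on UNIV (N \<psi>)"
      unfolding N_def \<phi>_def using k by (intro continuous_intros h) auto
    moreover have "\<forall>t. N \<psi> (t + T) = N \<psi> t" using that h(2) by (simp add: N_def X_def)
    ultimately show ?thesis
      using damped_constant_periodic_solution[of "N \<psi>" T c k] T c k(1) unfolding S_def by metis
  qed
  \<comment> \<open>Any choice will do: the estimates below use only that \<open>F \<psi>\<close> is
    a periodic solution with forcing \<open>N \<psi>\<close>.\<close>
  define F where "F \<psi> = (SOME x. S \<psi> x)" for \<psi>
  have F: "S \<psi> (F \<psi>)" if "\<psi> \<in> X" for \<psi>
    unfolding F_def using someI_ex[OF ex[OF that]] .
  have Nk: "N \<psi> t / k = \<phi> (apply_bcontfun \<psi> t) + h t / k" for \<psi> t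
    using k by (simp add: N_def field_simps)
  have bounds: "p \<le> F \<psi> t" "F \<psi> t \<le> r" if \<psi>: "\<psi> \<in> X" for \<psi> t
  proof -
    obtain y where y: "damped c (\<lambda>_. k) (N \<psi>) (F \<psi>) y" "\<forall>t. F \<psi> (t + T) = F \<psi> t"
      using F[OF \<psi>] by (auto simp: S_def)
    have "p \<le> N \<psi> t / k" for t
      using mono[of p "apply_bcontfun \<psi> t"] lo[of t] \<psi> unfolding Nk
      by (simp add: X_def \<phi>_def[of p] diff_divide_distrib)
    then show "p \<le> F \<psi> t" by (rule damped_constant_lower_bound[OF y(1) _ k y(2) T])
    have "N \<psi> t / k \<le> r" for t
      using mono[of "apply_bcontfun \<psi> t" r] hi[of t] \<psi> unfolding Nk
      by (simp add: X_def \<phi>_def[of r] diff_divide_distrib)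
    then show "F \<psi> t \<le> r" by (rule damped_constant_upper_bound[OF y(1) _ k y(2) T])
  qed
  have contF: "continuous_on UNIV (F \<psi>)" if "\<psi> \<in> X" for \<psi>
    using F[OF that] damped_continuous(1) unfolding S_def by blast
  have bc: "F \<psi> \<in> bcontfun" if "\<psi> \<in> X" for \<psi>
  proof (rule bcontfun_normI[OF contF[OF that]])
    show "norm (F \<psi> t) \<le> \<bar>p\<bar> + \<bar>r\<bar>" for t using bounds[OF that, of t] by auto
  qed
  define \<Phi> where "\<Phi> \<psi> = Bcontfun (F \<psi>)" for \<psi>
  have app: "apply_bcontfun (\<Phi> \<psi>) = F \<psi>" if "\<psi> \<in> X" for \<psi>
    unfolding \<Phi>_def by (rule Bcontfun_inverse[OF bc[OF that]])
  have maps: "\<Phi> ` X \<subseteq> X"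
  proof
    fix \<xi> assume "\<xi> \<in> \<Phi> ` X"
    then obtain \<psi> where \<psi>: "\<psi> \<in> X" "\<xi> = \<Phi> \<psi>" by auto
    show "\<xi> \<in> X" using bounds[OF \<psi>(1)] F[OF \<psi>(1)] unfolding X_def \<psi>(2)
      by (auto simp: app[OF \<psi>(1)] S_def)
  qed
  have contr: "dist (\<Phi> \<psi>) (\<Phi> \<xi>) \<le> \<theta> * dist \<psi> \<xi>" if \<psi>: "\<psi> \<in> X" and \<xi>: "\<xi> \<in> X" for \<psi> \<xi>
  proof (rule dist_bound)
    fix t
    obtain y where y: "damped c (\<lambda>_. k) (N \<psi>) (F \<psi>) y" "\<forall>t. F \<psi> (t + T) = F \<psi> t"
      using F[OF \<psi>] by (auto simp: S_def)
    obtain z where z: "damped c (\<lambda>_. k) (N \<xi>) (F \<xi>) z" "\<forall>t. F \<xi> (t + T) = F \<xi> t"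
      using F[OF \<xi>] by (auto simp: S_def)
    have D: "damped c (\<lambda>_. k) (\<lambda>t. N \<psi> t - N \<xi> t) (\<lambda>t. F \<psi> t - F \<xi> t) (\<lambda>t. y t - z t)"
      using damped_combine[OF y(1) z(1), of 1 "-1"] by simp
    have per: "\<forall>t. F \<psi> (t + T) - F \<xi> (t + T) = F \<psi> t - F \<xi> t" using y(2) z(2) by simp
    have bd: "\<bar>(N \<psi> s - N \<xi> s) / k\<bar> \<le> \<theta> * dist \<psi> \<xi>" for s
    proof -
      have "(N \<psi> s - N \<xi> s) / k = \<phi> (apply_bcontfun \<psi> s) - \<phi> (apply_bcontfun \<xi> s)"
        using k by (simp add: N_def field_simps)
      also have "\<bar>\<dots>\<bar> \<le> \<theta> * \<bar>apply_bcontfun \<psi> s - apply_bcontfun \<xi> s\<bar>"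
        using \<psi> \<xi> by (intro lip) (auto simp: X_def)
      also have "\<dots> \<le> \<theta> * dist \<psi> \<xi>"
        using \<theta>0 dist_bounded[of \<psi> s \<xi>] by (intro mult_left_mono) (auto simp: dist_real_def)
      finally show ?thesis .
    qed
    have "F \<psi> t - F \<xi> t \<le> \<theta> * dist \<psi> \<xi>"
      by (rule damped_constant_upper_bound[OF D _ k per T]) (use bd abs_le_iff in blast)
    moreover have "- (\<theta> * dist \<psi> \<xi>) \<le> F \<psi> t - F \<xi> t"
      by (rule damped_constant_lower_bound[OF D _ k per T]) (use bd abs_le_iff in \<open>metis minus_le_iff\<close>)
    ultimately show "dist (apply_bcontfun (\<Phi> \<psi>) t) (apply_bcontfun (\<Phi> \<xi>) t) \<le> \<theta> * dist \<psi> \<xi>"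
      using \<psi> \<xi> by (simp add: app dist_real_def abs_le_iff)
  qed
  obtain \<psi> where \<psi>: "\<psi> \<in> X" "\<Phi> \<psi> = \<psi>"
    using Banach_fix[OF X_complete X_ne \<theta>0 \<theta> maps contr] by blast
  have fixed: "F \<psi> = apply_bcontfun \<psi>" using app[OF \<psi>(1)] \<psi>(2) by simp
  obtain y where y: "damped c (\<lambda>_. k) (N \<psi>) (apply_bcontfun \<psi>) y"
    using F[OF \<psi>(1)] by (auto simp: S_def fixed)
  have rhs: "N \<psi> t - c * y t - k * apply_bcontfun \<psi> t
      = - c * y t - a * apply_bcontfun \<psi> t + (apply_bcontfun \<psi> t) ^ 3 + h t" for t
    using k by (simp add: N_def \<phi>_def field_simps)
  have "periodic_solution T c a h (apply_bcontfun \<psi>)"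
    unfolding periodic_solution_def
    by (rule exI[of _ y], unfold rhs[symmetric]) (use y \<psi>(1) in \<open>auto simp: damped_def X_def\<close>)
  then show thesis using that \<psi>(1) by (auto simp: X_def)
qed

section \<open>Multiplicity\<close>

text \<open>Absorbing the cubic into the potential opens the nonlinear equation to the linear
  comparison results.\<close>

lemma periodic_solution_damped:
  assumes "periodic_solution T c a h x"
  obtains y where "damped c (\<lambda>t. a - (x t)\<^sup>2) h x y" "\<forall>t. x (t + T) = x t"
proof -
  obtain y where y: "\<forall>t. (x has_real_derivative y t) (at t)"
    "\<forall>t. (y has_real_derivative (- c * y t - a * x t + (x t)^3 + h t)) (at t)" "\<forall>t. x (t + T) = x t"
    using assms unfolding periodic_solution_def by blast
  have "- c * y t - a * x t + (x t)^3 + h t = h t - c * y t - (a - (x t)\<^sup>2) * x t" for t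
    by (simp add: algebra_simps power2_eq_square power3_eq_cube)
  then have "damped c (\<lambda>t. a - (x t)\<^sup>2) h x y" using y(1,2) unfolding damped_def by (simp only: simp_thms)
  then show thesis using that y(3) by blast
qed

lemma periodic_solution_difference:
  assumes "periodic_solution T c a h x" "periodic_solution T c a h z"
  obtains w where
    "damped c (\<lambda>t. a - ((x t)\<^sup>2 + x t * z t + (z t)\<^sup>2)) (\<lambda>_. 0) (\<lambda>t. z t - x t) w"
    "\<forall>t. z (t + T) - x (t + T) = z t - x t"
proof -
  obtain y where y: "damped c (\<lambda>t. a - (x t)\<^sup>2) h x y" "\<forall>t. x (t + T) = x t"
    using periodic_solution_damped[OF assms(1)] .
  obtain w where w: "damped c (\<lambda>t. a - (z t)\<^sup>2) h z w" "\<forall>t. z (t + T) = z t"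
    using periodic_solution_damped[OF assms(2)] .
  have "damped c (\<lambda>t. a - ((x t)\<^sup>2 + x t * z t + (z t)\<^sup>2)) (\<lambda>_. 0) (\<lambda>t. z t - x t) (\<lambda>t. w t - y t)"
    unfolding damped_def
    by (auto intro!: derivative_eq_intros dampedD[OF y(1)] dampedD[OF w(1)]
        simp: algebra_simps power2_eq_square)
  then show thesis using that y(2) w(2) by simp
qed

lemma sum_squares_mult_nonneg: "0 \<le> x\<^sup>2 + x * z + z\<^sup>2" for x z :: real
proof -
  have "2 * (x\<^sup>2 + x * z + z\<^sup>2) = (x + z)\<^sup>2 + x\<^sup>2 + z\<^sup>2" by (simp add: power2_eq_square algebra_simps)
  also have "\<dots> \<ge> 0" by (intro add_nonneg_nonneg zero_le_power2)
  finally show ?thesis by simp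
qed

text \<open>The difference solves a homogeneous equation whose potential is a secant slope of
  \<open>a s - s^3\<close> and is at most \<open>a\<close>. By Sturm comparison a single zero would
  make it vanish identically.\<close>

lemma periodic_solutions_ordered:
  assumes x: "periodic_solution T c a h x" and z: "periodic_solution T c a h z" and ne: "x \<noteq> z"
    and T: "T > 0" and a: "a < (pi / T)\<^sup>2 + c\<^sup>2 / 4"
  shows "(\<forall>t. x t < z t) \<or> (\<forall>t. z t < x t)"
proof -
  obtain w where w: "damped c (\<lambda>t. a - ((x t)\<^sup>2 + x t * z t + (z t)\<^sup>2)) (\<lambda>_. 0) (\<lambda>t. z t - x t) w"
    "\<forall>t. z (t + T) - x (t + T) = z t - x t"
    using periodic_solution_difference[OF x z] .
  have q: "a - ((x t)\<^sup>2 + x t * z t + (z t)\<^sup>2) < (pi / T)\<^sup>2 + c\<^sup>2 / 4" for t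
    using a sum_squares_mult_nonneg[of "x t" "z t"] by linarith
  have "z t - x t \<noteq> 0" for t
  proof
    assume "z t - x t = 0"
    then have "z s - x s = 0" for s by (rule damped_periodic_zero[OF w(1) q w(2) T])
    then show False using ne by auto
  qed
  then have "(\<forall>t. z t - x t > 0) \<or> (\<forall>t. z t - x t < 0)"
    by (intro continuous_nonzero_sign damped_continuous(1)[OF w(1)]) auto
  then show ?thesis by simp
qed

text \<open>At a maximum of \<open>v / u\<close> the equation forces a positive second derivative of the quotient.\<close>

lemma positive_periodic_potentials_not_ordered:
  assumes u: "damped c q (\<lambda>_. 0) u u'" "\<And>t. u t > 0" "\<forall>t. u (t + T) = u t"
    and v: "damped c p (\<lambda>_. 0) v v'" "\<And>t. v t > 0" "\<forall>t. v (t + T) = v t"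
    and T: "T > 0" and less: "\<And>t. p t < q t"
  shows False
proof -
  define r where "r t = v t / u t" for t
  define r' where "r' t = (v' t * u t - v t * u' t) / (u t * u t)" for t
  have u0: "u t \<noteq> 0" for t using u(2)[of t] by simp
  have r: "(r has_real_derivative r' t) (at t)" for t
    unfolding r_def r'_def by (intro DERIV_divide dampedD(1)[OF u(1)] dampedD(1)[OF v(1)] u0)
  have "continuous_on UNIV r" using r continuous_on_if_has_real_derivative[of r r'] by blast
  then obtain t0 where max: "\<And>t. r t \<le> r t0"
    using periodic_attains_max[of r T] u(3) v(3) T by (auto simp: r_def)
  define W where "W t = v' t * u t - v t * u' t" for t
  have W: "(W has_real_derivative (- c * W t + (q t - p t) * (u t * v t))) (at t)" for t
    unfolding W_def
    by (auto intro!: derivative_eq_intros dampedD[OF u(1)] dampedD[OF v(1)] simp: algebra_simps)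
  \<comment> \<open>The quotient rule for \<open>r' = W / u\<^sup>2\<close>. At the maximum
    \<open>W\<close> is 0, which leaves only the term with \<open>q - p\<close>.\<close>
  define d where "d = ((- c * W t0 + (q t0 - p t0) * (u t0 * v t0)) * (u t0 * u t0)
      - W t0 * (u' t0 * u t0 + u' t0 * u t0)) / ((u t0 * u t0) * (u t0 * u t0))"
  have "(r' has_real_derivative d) (at t0)"
    unfolding r'_def d_def W_def[symmetric]
    by (intro DERIV_divide W DERIV_mult dampedD(1)[OF u(1)]) (use u0 in auto)
  from second_derivative_at_max[OF r this max] have "r' t0 = 0" "d \<le> 0" by auto
  then have "W t0 = 0" using u0 by (simp add: r'_def W_def)
  then have "d = (q t0 - p t0) * (u t0 * v t0) / (u t0 * u t0)"
    using u0[of t0] by (simp add: d_def)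
  also have "\<dots> > 0" using u(2)[of t0] v(2)[of t0] less[of t0] by simp
  finally show False using \<open>d \<le> 0\<close> by simp
qed

text \<open>The potentials of \<open>y - x\<close> and \<open>z - y\<close> are consecutive secant
  slopes of \<open>a s - s^3\<close>, strictly decreasing by strict concavity on the positive
  axis.\<close>

lemma no_three_positive_solutions:
  assumes x: "periodic_solution T c a h x" and y: "periodic_solution T c a h y"
    and z: "periodic_solution T c a h z" and T: "T > 0"
    and pos: "\<And>t. 0 < x t" and xy: "\<And>t. x t < y t" and yz: "\<And>t. y t < z t"
  shows False
proof -
  obtain u where u: "damped c (\<lambda>t. a - ((x t)\<^sup>2 + x t * y t + (y t)\<^sup>2)) (\<lambda>_. 0) (\<lambda>t. y t - x t) u"
    "\<forall>t. y (t + T) - x (t + T) = y t - x t"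
    using periodic_solution_difference[OF x y] .
  obtain v where v: "damped c (\<lambda>t. a - ((y t)\<^sup>2 + y t * z t + (z t)\<^sup>2)) (\<lambda>_. 0) (\<lambda>t. z t - y t) v"
    "\<forall>t. z (t + T) - y (t + T) = z t - y t"
    using periodic_solution_difference[OF y z] .
  have "(x t)\<^sup>2 + x t * y t + (y t)\<^sup>2 < (y t)\<^sup>2 + y t * z t + (z t)\<^sup>2" for t
  proof -
    \<comment> \<open>This product is exactly the difference of the two quadratic forms.\<close>
    have "0 < (z t - x t) * (x t + y t + z t)"
      using pos[of t] xy[of t] yz[of t] by (intro mult_pos_pos) auto
    then show ?thesis by (simp add: algebra_simps power2_eq_square)
  qed
  then have "a - ((y t)\<^sup>2 + y t * z t + (z t)\<^sup>2) < a - ((x t)\<^sup>2 + x t * y t + (y t)\<^sup>2)" for t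
    using diff_strict_left_mono by blast
  then show False
    using positive_periodic_potentials_not_ordered[OF u(1) _ u(2) v(1) _ v(2) T] xy yz
    by simp
qed

text \<open>At the maximum of \<open>x\<close> the product \<open>(a - x\<^sup>2) * x\<close> is at
  least \<open>h > 0\<close>; as \<open>x < 0\<close>, this forces \<open>x\<^sup>2 > a\<close>
  there.\<close>

lemma negative_solution_bound:
  assumes x: "periodic_solution T c a h x" and T: "T > 0" and a: "a > 0"
    and h: "\<And>t. h t > 0" and neg: "\<And>t. x t < 0"
  shows "x t < - sqrt a"
proof -
  obtain y where y: "damped c (\<lambda>t. a - (x t)\<^sup>2) h x y" "\<forall>t. x (t + T) = x t"
    using periodic_solution_damped[OF x] .
  obtain t0 where t0: "\<And>t. x t \<le> x t0" "h t0 \<le> (a - (x t0)\<^sup>2) * x t0"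
    using damped_at_max[OF y T] by blast
  have "0 < (a - (x t0)\<^sup>2) * x t0" using t0(2) h[of t0] by linarith
  then have "a < (- x t0)\<^sup>2" using neg[of t0] by (auto simp: zero_less_mult_iff)
  then have "sqrt a < - x t0" using neg[of t0] by (intro real_less_lsqrt) (auto simp: a less_imp_le)
  then show ?thesis using t0(1)[of t] by linarith
qed

text \<open>Below \<open>- sqrt a\<close> the potential of the difference is negative, so an ordered
  pair violates the maximum principle.\<close>

lemma negative_solution_unique:
  assumes x: "periodic_solution T c a h x" "\<And>t. x t < 0"
    and z: "periodic_solution T c a h z" "\<And>t. z t < 0"
    and T: "T > 0" and a: "0 < a" "a < (pi / T)\<^sup>2 + c\<^sup>2 / 4" and h: "\<And>t. h t > 0"
  shows "x = z"
proof (rule ccontr)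
  assume ne: "x \<noteq> z"
  have False if x: "periodic_solution T c a h x" "\<And>t. x t < 0"
    and z: "periodic_solution T c a h z" "\<And>t. z t < 0" and less: "\<And>t. x t < z t" for x z
  proof -
    obtain w where w: "damped c (\<lambda>t. a - ((x t)\<^sup>2 + x t * z t + (z t)\<^sup>2)) (\<lambda>_. 0) (\<lambda>t. z t - x t) w"
      "\<forall>t. z (t + T) - x (t + T) = z t - x t"
      using periodic_solution_difference[OF x(1) z(1)] .
    obtain t0 where t0: "0 \<le> (a - ((x t0)\<^sup>2 + x t0 * z t0 + (z t0)\<^sup>2)) * (z t0 - x t0)"
      using damped_at_max[OF w T] by blast
    have "sqrt a < - z t0" using negative_solution_bound[OF z(1) T a(1) h z(2), of t0] by linarith
    then have "(sqrt a)\<^sup>2 < (- z t0)\<^sup>2" using a by (intro power_strict_mono) auto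
    then have "a < (z t0)\<^sup>2" using a by simp
    moreover have "0 < x t0 * z t0" using x(2)[of t0] z(2)[of t0] by (simp add: mult_neg_neg)
    ultimately have "a - ((x t0)\<^sup>2 + x t0 * z t0 + (z t0)\<^sup>2) < 0"
      using zero_le_power2[of "x t0"] by linarith
    then show False using t0 less[of t0] by (simp add: zero_le_mult_iff)
  qed
  then show False using periodic_solutions_ordered[OF x(1) z(1) ne T a(2)] x z by blast
qed

section \<open>Floquet multipliers\<close>

lemma lin_sol_iff_damped:
  "lin_sol c a x uv \<longleftrightarrow> damped c (\<lambda>t. a - 3 * (x t)\<^sup>2) (\<lambda>_. 0) (fst uv) (snd uv)"
  by (simp add: lin_sol_def damped_def)

lemma damped_unique:
  assumes "damped c q g u v" "damped c q g u' v'" "\<And>t. \<bar>q t\<bar> \<le> Q" "u 0 = u' 0" "v 0 = v' 0"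
  shows "u = u'" "v = v'"
proof -
  have "damped c q (\<lambda>_. 0) (\<lambda>t. u t - u' t) (\<lambda>t. v t - v' t)"
    using damped_combine[OF assms(1,2), of 1 "-1"] by simp
  then have "u t - u' t = 0 \<and> v t - v' t = 0" for t
    by (rule damped_zero_unique[OF _ assms(3), where ?t0.0 = 0]) (use assms(4,5) in auto)
  then show "u = u'" "v = v'" by auto
qed

text \<open>Existence and uniqueness for the Cauchy problem let the definite descriptions in
  \<open>fund1\<close> and \<open>fund2\<close> denote actual solutions, with which all later
  arguments work.\<close>

lemma floquet_multipliers_fundamental:
  fixes T c a :: real
  assumes x: "continuous_on UNIV x" "\<forall>t. x (t + T) = x t" and T: "T > 0"
  defines "q \<equiv> \<lambda>t. a - 3 * (x t)\<^sup>2"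
  obtains Q u1 v1 u2 v2 where "\<And>t. \<bar>q t\<bar> \<le> Q"
    "damped c q (\<lambda>_. 0) u1 v1" "u1 0 = 1" "v1 0 = 0"
    "damped c q (\<lambda>_. 0) u2 v2" "u2 0 = 0" "v2 0 = 1"
    "floquet_multipliers T c a x = {\<mu>. (\<mu> - complex_of_real (u1 T)) * (\<mu> - complex_of_real (v2 T))
       - complex_of_real (u2 T) * complex_of_real (v1 T) = 0}"
proof -
  have cq: "continuous_on UNIV q" unfolding q_def by (intro continuous_intros x)
  have "\<forall>t. q (t + T) = q t" using x(2) by (simp add: q_def)
  then obtain Q where Q: "\<And>t. \<bar>q t\<bar> \<le> Q" using periodic_bounded[OF cq _ T] by blast
  obtain u1 v1 where 1: "damped c q (\<lambda>_. 0) u1 v1" "u1 0 = 1" "v1 0 = 0"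
    using damped_exists[OF cq Q] by blast
  obtain u2 v2 where 2: "damped c q (\<lambda>_. 0) u2 v2" "u2 0 = 0" "v2 0 = 1"
    using damped_exists[OF cq Q] by blast
  have f1: "fund1 c a x = (u1, v1)"
    unfolding fund1_def lin_sol_iff_damped q_def[symmetric]
  proof (rule the_equality)
    fix uv assume uv: "damped c q (\<lambda>_. 0) (fst uv) (snd uv) \<and> fst uv 0 = 1 \<and> snd uv 0 = 0"
    then have D: "damped c q (\<lambda>_. 0) (fst uv) (snd uv)" and "fst uv 0 = u1 0" "snd uv 0 = v1 0"
      by (simp_all add: 1)
    then have "fst uv = u1" "snd uv = v1" using damped_unique[OF D 1(1) Q] by blast+
    then show "uv = (u1, v1)" by (auto simp: prod_eq_iff)
  qed (use 1 in auto)
  have f2: "fund2 c a x = (u2, v2)"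
    unfolding fund2_def lin_sol_iff_damped q_def[symmetric]
  proof (rule the_equality)
    fix uv assume uv: "damped c q (\<lambda>_. 0) (fst uv) (snd uv) \<and> fst uv 0 = 0 \<and> snd uv 0 = 1"
    then have D: "damped c q (\<lambda>_. 0) (fst uv) (snd uv)" and "fst uv 0 = u2 0" "snd uv 0 = v2 0"
      by (simp_all add: 2)
    then have "fst uv = u2" "snd uv = v2" using damped_unique[OF D 2(1) Q] by blast+
    then show "uv = (u2, v2)" by (auto simp: prod_eq_iff)
  qed (use 2 in auto)
  have "floquet_multipliers T c a x = {\<mu>. (\<mu> - complex_of_real (u1 T)) * (\<mu> - complex_of_real (v2 T))
       - complex_of_real (u2 T) * complex_of_real (v1 T) = 0}"
    by (simp add: floquet_multipliers_def monodromy_def f1 f2 Let_def)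
  then show thesis by (rule that[OF Q 1 2])
qed

text \<open>Liouville's formula; at \<open>t = T\<close> it gives the determinant of the monodromy
  matrix.\<close>

lemma damped_wronskian:
  assumes 1: "damped c q (\<lambda>_. 0) u1 v1" "u1 0 = 1" "v1 0 = 0"
    and 2: "damped c q (\<lambda>_. 0) u2 v2" "u2 0 = 0" "v2 0 = 1"
  shows "u1 t * v2 t - u2 t * v1 t = exp (- c * t)"
proof -
  define W where "W t = exp (c * t) * (u1 t * v2 t - u2 t * v1 t)" for t
  have "(W has_real_derivative 0) (at s)" for s
    unfolding W_def
    by (auto intro!: derivative_eq_intros dampedD[OF 1(1)] dampedD[OF 2(1)] simp: algebra_simps)
  then have "W t = W 0" using DERIV_const_ratio_const DERIV_isconst_all by blast
  then have "exp (c * t) * (u1 t * v2 t - u2 t * v1 t) = 1" using 1 2 by (simp add: W_def)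
  then show ?thesis by (simp add: exp_minus field_simps)
qed

text \<open>For negative \<open>q\<close> the function \<open>exp (c t) u v\<close> is increasing, so the solutions leave the axes.\<close>

lemma damped_negative_potential_product:
  assumes D: "damped c q (\<lambda>_. 0) u v" and q: "\<And>t. q t < 0" "\<And>t. \<bar>q t\<bar> \<le> Q"
    and init: "u 0 * v 0 = 0" "u 0 \<noteq> 0 \<or> v 0 \<noteq> 0" and t: "t > 0"
  shows "u t * v t > 0"
proof -
  define P where "P t = exp (c * t) * (u t * v t)" for t
  have "P 0 < P t"
  proof (rule DERIV_pos_imp_increasing[OF t])
    fix s
    have "(P has_real_derivative exp (c * s) * ((v s)\<^sup>2 - q s * (u s)\<^sup>2)) (at s)"
      unfolding P_def
      by (auto intro!: derivative_eq_intros dampedD[OF D] simp: algebra_simps power2_eq_square)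
    moreover have "(v s)\<^sup>2 - q s * (u s)\<^sup>2 > 0"
    proof (cases "u s = 0")
      case True
      then have "v s \<noteq> 0" using damped_zero_unique[OF D q(2), of s 0] init(2) by blast
      then show ?thesis using True by simp
    next
      case False
      then have "q s * (u s)\<^sup>2 < 0" using q(1)[of s] by (simp add: mult_neg_pos)
      then show ?thesis using zero_le_power2[of "v s"] by linarith
    qed
    ultimately show "\<exists>y. (P has_real_derivative y) (at s) \<and> 0 < y"
      by (intro exI conjI) (assumption, simp)
  qed
  then show ?thesis using init(1) by (simp add: P_def zero_less_mult_iff)
qed

text \<open>All entries of the monodromy matrix are positive, with \<open>u1 T > 1\<close> and
  \<open>v2 T > exp (- c * T)\<close>. Hence the characteristic polynomial \<open>p\<close> is
  negative at 1 and has a root beyond.\<close>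

lemma unstable_if_potential_negative:
  assumes x: "continuous_on UNIV x" "\<forall>t. x (t + T) = x t" and T: "T > 0"
    and q: "\<And>t. a < 3 * (x t)\<^sup>2"
  shows "unstable T c a x"
proof -
  define q where "q t = a - 3 * (x t)\<^sup>2" for t
  have qneg: "q t < 0" for t using q[of t] by (simp add: q_def)
  obtain Q u1 v1 u2 v2 where Q: "\<And>t. \<bar>q t\<bar> \<le> Q"
    and 1: "damped c q (\<lambda>_. 0) u1 v1" "u1 0 = 1" "v1 0 = 0"
    and 2: "damped c q (\<lambda>_. 0) u2 v2" "u2 0 = 0" "v2 0 = 1"
    and mult: "floquet_multipliers T c a x = {\<mu>. (\<mu> - complex_of_real (u1 T)) * (\<mu> - complex_of_real (v2 T))
       - complex_of_real (u2 T) * complex_of_real (v1 T) = 0}"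
    using floquet_multipliers_fundamental[OF x T, of a c, folded q_def] by blast
  have p1: "u1 t * v1 t > 0" and p2: "u2 t * v2 t > 0" if "t > 0" for t
    using damped_negative_potential_product[OF 1(1) qneg Q _ _ that]
      damped_negative_potential_product[OF 2(1) qneg Q _ _ that] 1 2 by auto
  have pos: "f t > 0" if f: "continuous_on UNIV f" "f 0 = 1" "\<And>s. s > 0 \<Longrightarrow> f s \<noteq> 0" "t \<ge> 0"
    for f :: "real \<Rightarrow> real" and t
  proof (rule ccontr)
    assume "\<not> 0 < f t"
    then obtain s where "0 \<le> s" "s \<le> t" "f s = 0"
      using IVT2'[of f t 0 0] f(2,4) continuous_on_subset[OF f(1)] by auto
    then show False using f(2) f(3)[of s] by (cases "s = 0") auto
  qed
  have u1: "u1 t > 0" if "t \<ge> 0" for t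
    by (rule pos[OF damped_continuous(1)[OF 1(1)] 1(2) _ that]) (use p1 in force)
  have v1: "v1 t > 0" if "t > 0" for t using p1[OF that] u1[of t] that by (simp add: zero_less_mult_iff)
  have v2: "v2 t > 0" if "t \<ge> 0" for t
    by (rule pos[OF damped_continuous(2)[OF 2(1)] 2(3) _ that]) (use p2 in force)
  have u2: "u2 t > 0" if "t > 0" for t using p2[OF that] v2[of t] that by (simp add: zero_less_mult_iff)
  have "u1 0 < u1 T"
    by (rule DERIV_pos_imp_increasing_open[OF T])
      (use v1 dampedD(1)[OF 1(1)] damped_continuous(1)[OF 1(1)] in blast)+
  then have u1T: "u1 T > 1" using 1 by simp
  \<comment> \<open>The exponential cancels the damping, so \<open>E\<close> increases where
    \<open>u2\<close> is positive.\<close>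
  define E where "E t = exp (c * t) * v2 t" for t
  have E: "(E has_real_derivative exp (c * t) * (- q t * u2 t)) (at t)" for t
    unfolding E_def by (auto intro!: derivative_eq_intros dampedD[OF 2(1)] simp: algebra_simps)
  have "E 0 < E T"
  proof (rule DERIV_pos_imp_increasing_open[OF T])
    fix t assume "0 < t" "t < T"
    then have "exp (c * t) * (- q t * u2 t) > 0" using u2[of t] qneg[of t] by (intro mult_pos_pos) auto
    then show "\<exists>y. (E has_real_derivative y) (at t) \<and> 0 < y" using E by blast
  next
    show "continuous_on {0..T} E" by (rule continuous_on_if_has_real_derivative, rule allI, rule E)
  qed
  then have v2T: "v2 T > exp (- c * T)" using 2 by (simp add: E_def exp_minus field_simps)
  define p where "p \<mu> = (\<mu> - u1 T) * (\<mu> - v2 T) - u2 T * v1 T" for \<mu>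
  have W: "u1 T * v2 T - u2 T * v1 T = exp (- c * T)" by (rule damped_wronskian[OF 1 2])
  have "p 1 = 1 - (u1 T + v2 T) + exp (- c * T)" unfolding p_def W[symmetric] by (simp add: algebra_simps)
  then have "p 1 < 0" using u1T v2T by linarith
  \<comment> \<open>At the trace the characteristic polynomial equals the determinant, hence the
    trace is a right end point with positive value.\<close>
  moreover have "p (u1 T + v2 T) = exp (- c * T)" unfolding p_def W[symmetric] by (simp add: algebra_simps)
  then have "p (u1 T + v2 T) > 0" by simp
  moreover have "v2 T > 0" using v2 T by simp
  moreover have "continuous_on {1..u1 T + v2 T} p" unfolding p_def by (intro continuous_intros)
  ultimately obtain \<mu> where \<mu>: "1 \<le> \<mu>" "p \<mu> = 0"
    using IVT'[of p 1 0 "u1 T + v2 T"] u1T by auto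
  then have "\<mu> > 1" using \<open>p 1 < 0\<close> by (cases "\<mu> = 1") auto
  moreover have "complex_of_real \<mu> \<in> floquet_multipliers T c a x"
  proof -
    have "(complex_of_real \<mu> - complex_of_real (u1 T)) * (complex_of_real \<mu> - complex_of_real (v2 T))
       - complex_of_real (u2 T) * complex_of_real (v1 T) = complex_of_real (p \<mu>)"
      by (simp add: p_def)
    then show ?thesis using \<mu>(2) unfolding mult by simp
  qed
  ultimately show ?thesis unfolding unstable_def by (intro bexI[of _ "complex_of_real \<mu>"]) auto
qed

section \<open>Asymptotic stability for positive potentials\<close>

lemma eigenvector_2x2:
  fixes A B C D r :: real
  assumes "(r - A) * (r - D) - B * C = 0"
  obtains \<alpha> \<beta> where "\<alpha> \<noteq> 0 \<or> \<beta> \<noteq> 0" "A * \<alpha> + B * \<beta> = r * \<alpha>" "C * \<alpha> + D * \<beta> = r * \<beta>"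
proof (cases "B = 0")
  case False
  show thesis
    by (rule that[of B "r - A"]) (use False assms in \<open>auto simp: algebra_simps\<close>)
next
  case True
  show thesis
  proof (cases "r = D")
    case True
    then show thesis using that[of 0 1] \<open>B = 0\<close> by simp
  next
    case False
    then have "r = A" using assms \<open>B = 0\<close> by auto
    then show thesis using that[of "A - D" C] False \<open>B = 0\<close> by (auto simp: algebra_simps)
  qed
qed

lemma damped_positive_potential_not_periodic:
  assumes D: "damped c q (\<lambda>_. 0) u v" and q: "\<And>t. q t > 0"
    and per: "\<forall>t. u (t + T) = u t" "T > 0" and nz: "\<And>t. u t \<noteq> 0"
  shows False
  using continuous_nonzero_sign[OF damped_continuous(1)[OF D] nz]
proof
  assume pos: "\<forall>t. u t > 0"
  obtain t0 where "q t0 * u t0 \<le> 0" using damped_at_min[OF D per] by blast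
  then show False using mult_pos_pos[OF q[of t0]] pos by (meson not_le)
next
  assume neg: "\<forall>t. u t < 0"
  obtain t0 where "0 \<le> q t0 * u t0" using damped_at_max[OF D per] by blast
  then show False using mult_pos_neg[OF q[of t0]] neg by (meson not_le)
qed

text \<open>A zero would recur after time \<open>T\<close>; Sturm comparison for \<open>u\<close>
  and \<open>- u\<close> would then make the solution vanish in between. So \<open>u\<close> keeps
  its sign and \<open>r > 0\<close>. If \<open>r \<ge> 1\<close>, the periodic part of
  \<open>u\<close> would contradict the extremum principle.\<close>

lemma damped_floquet_solution_exponent:
  assumes D: "damped c q (\<lambda>_. 0) u v" and c: "c > 0" and T: "T > 0"
    and q: "\<And>t. 0 < q t" "\<And>t. q t < (pi / T)\<^sup>2 + c\<^sup>2 / 4" "\<And>t. \<bar>q t\<bar> \<le> Q"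
    and nz: "u 0 \<noteq> 0 \<or> v 0 \<noteq> 0" and per: "\<And>t. u (t + T) = r * u t"
  shows "0 < r" "r < 1"
proof -
  have nz: "u t \<noteq> 0" for t
  proof
    assume z: "u t = 0"
    then have z': "u (t + T) = 0" using per by simp
    have zero: "u s = 0" if s: "t \<le> s" "s \<le> t + T" for s
      using damped_nonpos_between_zeros[OF D _ q(2) z z' s]
        damped_nonpos_between_zeros[OF damped_uminus[OF D] _ q(2), of t s] z z' s by simp
    \<comment> \<open>The midpoint lies inside an interval on which \<open>u\<close> vanishes, so
      the velocity is 0 there as well.\<close>
    have "u (t + T / 2) = 0" using zero T by simp
    moreover have "v (t + T / 2) = 0"
    proof (rule DERIV_local_max[OF dampedD(1)[OF D]])
      show "0 < T / 2" using T by simp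
      show "\<forall>s. \<bar>t + T / 2 - s\<bar> < T / 2 \<longrightarrow> u s \<le> u (t + T / 2)"
      proof (intro allI impI)
        fix s assume "\<bar>t + T / 2 - s\<bar> < T / 2"
        then have "t \<le> s" "s \<le> t + T" by linarith+
        then show "u s \<le> u (t + T / 2)" using zero T by simp
      qed
    qed
    ultimately show False using damped_zero_unique[OF D q(3), of "t + T / 2" 0] assms(7) by blast
  qed
  have "(\<forall>t. u t > 0) \<or> (\<forall>t. u t < 0)"
    by (rule continuous_nonzero_sign[OF damped_continuous(1)[OF D] nz])
  then have "u T * u 0 > 0" by (auto intro: mult_pos_pos mult_neg_neg)
  moreover have "u T * u 0 = r * (u 0)\<^sup>2" using per[of 0] by (simp add: power2_eq_square)
  ultimately show r: "r > 0" by (simp add: zero_less_mult_iff)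
  show "r < 1"
  proof (rule ccontr)
    assume "\<not> r < 1"
    define \<rho> where "\<rho> = ln r / T"
    have \<rho>: "\<rho> \<ge> 0" using \<open>\<not> r < 1\<close> T by (simp add: \<rho>_def)
    have r_eq: "exp (\<rho> * T) = r" using r T by (simp add: \<rho>_def)
    define p where "p t = exp (- \<rho> * t) * u t" for t
    \<comment> \<open>Substituting \<open>u = exp (\<rho> t) p\<close> changes damping and
      potential; for \<open>\<rho> \<ge> 0\<close> the new potential is still positive.\<close>
    have D': "damped (c + 2 * \<rho>) (\<lambda>t. \<rho>\<^sup>2 + c * \<rho> + q t) (\<lambda>_. 0) p (\<lambda>t. exp (- \<rho> * t) * (v t - \<rho> * u t))"
      unfolding damped_def p_def
      by (auto intro!: derivative_eq_intros dampedD[OF D] simp: algebra_simps power2_eq_square)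
    show False
    proof (rule damped_positive_potential_not_periodic[OF D' _ _ T])
      show "0 < \<rho>\<^sup>2 + c * \<rho> + q t" for t
        using \<rho> c q(1)[of t] by (intro add_nonneg_pos) auto
      have "exp (- \<rho> * (t + T)) * r = exp (- \<rho> * t)" for t
        unfolding r_eq[symmetric] by (simp add: algebra_simps flip: exp_add)
      then show "\<forall>t. p (t + T) = p t" unfolding p_def per by (simp flip: mult.assoc)
      show "p t \<noteq> 0" for t using nz by (simp add: p_def)
    qed
  qed
qed

lemma asympt_stable_if_potential_positive:
  assumes x: "continuous_on UNIV x" "\<forall>t. x (t + T) = x t" and T: "T > 0" and c: "c > 0"
    and a: "a < (pi / T)\<^sup>2 + c\<^sup>2 / 4" and pos: "\<And>t. 3 * (x t)\<^sup>2 < a"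
  shows "asympt_stable T c a x"
  unfolding asympt_stable_def
proof
  fix \<mu> assume \<mu>: "\<mu> \<in> floquet_multipliers T c a x"
  define q where "q t = a - 3 * (x t)\<^sup>2" for t
  have q: "0 < q t" "q t < (pi / T)\<^sup>2 + c\<^sup>2 / 4" for t
    using pos[of t] a zero_le_power2[of "x t"] unfolding q_def by linarith+
  have perq: "q (t + T) = q t" for t using x(2) by (simp add: q_def)
  obtain Q u1 v1 u2 v2 where Q: "\<And>t. \<bar>q t\<bar> \<le> Q"
    and 1: "damped c q (\<lambda>_. 0) u1 v1" "u1 0 = 1" "v1 0 = 0"
    and 2: "damped c q (\<lambda>_. 0) u2 v2" "u2 0 = 0" "v2 0 = 1"
    and mult: "floquet_multipliers T c a x = {\<mu>. (\<mu> - complex_of_real (u1 T)) * (\<mu> - complex_of_real (v2 T))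
       - complex_of_real (u2 T) * complex_of_real (v1 T) = 0}"
    using floquet_multipliers_fundamental[OF x T, of a c, folded q_def] by blast
  have W: "u1 T * v2 T - u2 T * v1 T = exp (- c * T)" by (rule damped_wronskian[OF 1 2])
  have char: "(\<mu> - complex_of_real (u1 T)) * (\<mu> - complex_of_real (v2 T))
       - complex_of_real (u2 T) * complex_of_real (v1 T) = 0"
    using \<mu> unfolding mult by simp
  have re: "(Re \<mu> - u1 T) * (Re \<mu> - v2 T) - (Im \<mu>)\<^sup>2 - u2 T * v1 T = 0"
    using arg_cong[OF char, of Re] by (simp add: power2_eq_square)
  have im: "Im \<mu> * (2 * Re \<mu> - u1 T - v2 T) = 0"
    using arg_cong[OF char, of Im] by (simp add: algebra_simps)
  show "cmod \<mu> < 1"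
  proof (cases "Im \<mu> = 0")
    case False
    \<comment> \<open>The trace is \<open>2 * Re \<mu>\<close>, so the real part of the
      characteristic equation says that the squared modulus is the determinant.\<close>
    then have s: "u1 T = 2 * Re \<mu> - v2 T" using im by simp
    have "(Re \<mu>)\<^sup>2 + (Im \<mu>)\<^sup>2 = exp (- c * T)"
      using re W unfolding s by (simp add: algebra_simps power2_eq_square)
    also have "\<dots> < 1" using c T by simp
    finally show ?thesis by (simp add: cmod_def)
  next
    case True
    define r where "r = Re \<mu>"
    have "(r - u1 T) * (r - v2 T) - u2 T * v1 T = 0" using re True by (simp add: r_def)
    then obtain \<alpha> \<beta> where \<alpha>\<beta>: "\<alpha> \<noteq> 0 \<or> \<beta> \<noteq> 0" "u1 T * \<alpha> + u2 T * \<beta> = r * \<alpha>" "v1 T * \<alpha> + v2 T * \<beta> = r * \<beta>"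
      by (rule eigenvector_2x2)
    define u where "u = (\<lambda>t. \<alpha> * u1 t + \<beta> * u2 t)"
    define v where "v = (\<lambda>t. \<alpha> * v1 t + \<beta> * v2 t)"
    have D: "damped c q (\<lambda>_. 0) u v"
      using damped_combine[OF 1(1) 2(1), of \<alpha> \<beta>] by (simp add: u_def v_def)
    have D': "damped c q (\<lambda>_. 0) (\<lambda>t. u (t + T)) (\<lambda>t. v (t + T))"
      using damped_shift[OF D, of T] by (simp add: perq)
    \<comment> \<open>By the eigenvector property this solution has zero data at time 0, so it
      vanishes and \<open>u\<close> is a Floquet solution with multiplier \<open>r\<close>.\<close>
    have "damped c q (\<lambda>_. 0) (\<lambda>t. 1 * u (t + T) + (- r) * u t) (\<lambda>t. 1 * v (t + T) + (- r) * v t)"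
      using damped_combine[OF D' D, of 1 "- r"] by simp
    then have "1 * u (t + T) + (- r) * u t = 0 \<and> 1 * v (t + T) + (- r) * v t = 0" for t
      by (rule damped_zero_unique[OF _ Q, where ?t0.0 = 0])
        (use 1 2 \<alpha>\<beta> in \<open>auto simp: u_def v_def algebra_simps\<close>)
    then have per: "u (t + T) = r * u t" for t by simp
    have "u 0 \<noteq> 0 \<or> v 0 \<noteq> 0" using \<alpha>\<beta>(1) 1 2 by (simp add: u_def v_def)
    then have "0 < r" "r < 1" using damped_floquet_solution_exponent[OF D c T q Q _ per] by auto
    then show ?thesis using True by (simp add: cmod_def r_def)
  qed
qed

section \<open>The Duffing equation\<close>

lemma duffing_negative_solution_exists:
  assumes T: "T > 0" and c: "c > 0" and a: "a > 0"
    and h: "continuous_on UNIV h" "\<forall>t. h (t + T) = h t" "\<And>t. h t > 0"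
  obtains x where "periodic_solution T c a h x" "\<And>t. x t < 0"
proof -
  obtain t0 where H: "\<And>t. h t \<le> h t0" using periodic_attains_max[OF h(1,2) T] by blast
  define s where "s = sqrt a"
  have s: "s > 0" "a = s\<^sup>2" using a by (auto simp: s_def)
  \<comment> \<open>Chosen so that \<open>s * (B - s) * (s + s)\<close> is exactly the maximum of
    \<open>h\<close>; hence \<open>B ^ 3 - a * B\<close> dominates \<open>h\<close>, as the lower
    end \<open>- B\<close> requires.\<close>
  define B where "B = s + h t0 / (2 * a)"
  have Bs: "B > s" using h(3)[of t0] a by (simp add: B_def)
  have "h t0 = s * (B - s) * (s + s)" using s(1) by (simp add: B_def s(2) power2_eq_square)
  also have "\<dots> \<le> B * (B - s) * (B + s)" using Bs s(1) by (intro mult_mono) auto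
  also have "\<dots> = B ^ 3 - a * B" by (simp add: s(2) algebra_simps power2_eq_square power3_eq_cube)
  finally have B: "h t0 \<le> B ^ 3 - a * B" .
  have B0: "B > 0" using Bs s(1) by simp
  obtain x where x: "periodic_solution T c a h x" "\<And>t. x t \<le> - s"
  \<comment> \<open>The value \<open>- 3 * B\<^sup>2\<close> lies below the derivative
    \<open>a - 3 * w\<^sup>2\<close> on the interval; the bound \<open>a \<le> w\<^sup>2\<close>
    gives the contraction constant.\<close>
  proof (rule duffing_solution_between[OF h(1,2) T c, of "- 3 * B\<^sup>2" "- B" "- s" "1 - 2 * a / (3 * B\<^sup>2)" a])
    show "- 3 * B\<^sup>2 \<noteq> 0" using B0 by simp
    have "- 3 * B\<^sup>2 < 0" using B0 by simp
    also have "0 < (pi / T)\<^sup>2 + c\<^sup>2 / 4" using T c by (intro add_pos_pos) auto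
    finally show "- 3 * B\<^sup>2 < (pi / T)\<^sup>2 + c\<^sup>2 / 4" .
    show "- B \<le> - s" using Bs by simp
    show "1 - 2 * a / (3 * B\<^sup>2) < 1" using a B0 by simp
    fix w assume w: "- B \<le> w" "w \<le> - s"
    have w1: "w\<^sup>2 \<le> B\<^sup>2" using w s(1) Bs by (simp add: abs_le_square_iff[symmetric])
    have w2: "a \<le> w\<^sup>2" unfolding s(2) using w s(1) by (simp add: abs_le_square_iff[symmetric])
    have "1 - (a - 3 * w\<^sup>2) / (- 3 * B\<^sup>2) = (3 * B\<^sup>2 - 3 * w\<^sup>2 + a) / (3 * B\<^sup>2)"
      using B0 by (simp add: field_simps)
    moreover have "1 - 2 * a / (3 * B\<^sup>2) = (3 * B\<^sup>2 - 2 * a) / (3 * B\<^sup>2)"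
      using B0 by (simp add: field_simps)
    ultimately show "0 \<le> 1 - (a - 3 * w\<^sup>2) / (- 3 * B\<^sup>2) \<and>
        1 - (a - 3 * w\<^sup>2) / (- 3 * B\<^sup>2) \<le> 1 - 2 * a / (3 * B\<^sup>2)"
      using w1 w2 a B0 by (auto intro!: divide_right_mono divide_nonneg_pos)
  next
    fix t
    have "0 \<le> a * - B - (- B) ^ 3 - h t" using B H[of t] by simp
    then show "(a * - B - (- B) ^ 3 - h t) / (- 3 * B\<^sup>2) \<le> 0"
      using B0 by (intro divide_nonneg_neg) auto
    have "a * - s - (- s) ^ 3 - h t \<le> 0"
      using h(3)[of t] by (simp add: s(2) power2_eq_square power3_eq_cube)
    then show "0 \<le> (a * - s - (- s) ^ 3 - h t) / (- 3 * B\<^sup>2)"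
      using B0 by (intro divide_nonpos_neg) auto
  qed (rule that)
  have "x t < 0" for t using x(2)[of t] s(1) by linarith
  then show thesis using that x(1) by blast
qed

lemma duffing_middle_solution_exists:
  assumes T: "T > 0" and c: "c > 0" and a: "a = 3 * m\<^sup>2" "m > 0" "a < (pi / T)\<^sup>2 + c\<^sup>2 / 4"
    and h: "continuous_on UNIV h" "\<forall>t. h (t + T) = h t" "\<And>t. h t > 0" "\<And>t. h t < 2 * m ^ 3"
  obtains x where "periodic_solution T c a h x" "\<And>t. 0 \<le> x t" "\<And>t. x t < m"
proof -
  obtain t0 where H: "\<And>t. h t \<le> h t0" using periodic_attains_max[OF h(1,2) T] by blast
  have fm: "a * m - m ^ 3 = 2 * m ^ 3" by (simp add: a(1) power2_eq_square power3_eq_cube)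
  have "continuous_on {0..m} (\<lambda>s. a * s - s ^ 3)" by (intro continuous_intros)
  \<comment> \<open>The level of the maximum of \<open>h\<close>, taken before the turning point
    \<open>m\<close>. Stopping at \<open>r < m\<close> keeps the contraction constant
    \<open>3 * r\<^sup>2 / a\<close> below 1.\<close>
  then obtain r where r: "0 \<le> r" "r \<le> m" "a * r - r ^ 3 = h t0"
    using IVT'[of "\<lambda>s. a * s - s ^ 3" 0 "h t0" m] h(3,4)[of t0] a(2) fm by auto
  have "r \<noteq> m" using r(3) h(4)[of t0] fm by auto
  then have rm: "r < m" using r(2) by simp
  then have r2: "3 * r\<^sup>2 < a" unfolding a(1) using r(1) by (simp add: power_strict_mono)
  have a0: "a > 0" using a by simp
  obtain x where x: "periodic_solution T c a h x" "\<And>t. 0 \<le> x t" "\<And>t. x t \<le> r"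
  proof (rule duffing_solution_between[OF h(1,2) T c _ a(3) r(1), of "3 * r\<^sup>2 / a" a])
    show "a \<noteq> 0" "3 * r\<^sup>2 / a < 1" using a0 r2 by auto
    fix s assume s: "0 \<le> s" "s \<le> r"
    have "s\<^sup>2 \<le> r\<^sup>2" using s by (intro power_mono) auto
    moreover have "1 - (a - 3 * s\<^sup>2) / a = 3 * s\<^sup>2 / a" using a0 by (simp add: field_simps)
    ultimately show "0 \<le> 1 - (a - 3 * s\<^sup>2) / a \<and> 1 - (a - 3 * s\<^sup>2) / a \<le> 3 * r\<^sup>2 / a"
      using a0 by (auto intro!: divide_right_mono)
  next
    fix t
    show "(a * 0 - 0 ^ 3 - h t) / a \<le> 0" using a0 h(3)[of t] by simp
    show "0 \<le> (a * r - r ^ 3 - h t) / a" using a0 r(3) H[of t] by simp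
  qed (rule that)
  have "x t < m" for t using x(3)[of t] rm by linarith
  then show thesis using that x by blast
qed

lemma duffing_upper_solution_exists:
  assumes T: "T > 0" and c: "c > 0" and a: "a = 3 * m\<^sup>2" "m > 0"
    and h: "continuous_on UNIV h" "\<forall>t. h (t + T) = h t" "\<And>t. h t > 0" "\<And>t. h t < 2 * m ^ 3"
  obtains x where "periodic_solution T c a h x" "\<And>t. m < x t"
proof -
  obtain t0 where H: "\<And>t. h t \<le> h t0" using periodic_attains_max[OF h(1,2) T] by blast
  have fm: "a * m - m ^ 3 = 2 * m ^ 3" by (simp add: a(1) power2_eq_square power3_eq_cube)
  have a0: "a > 0" using a by simp
  define s where "s = sqrt a"
  have s: "s > 0" "a = s\<^sup>2" using a0 by (auto simp: s_def)
  have "m\<^sup>2 \<le> s\<^sup>2" unfolding s(2)[symmetric] a(1) by simp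
  then have ms: "m \<le> s" by (rule power2_le_imp_le) (use s(1) in simp)
  have fs: "a * s - s ^ 3 = 0" by (simp add: s(2) power2_eq_square power3_eq_cube)
  have "continuous_on {m..s} (\<lambda>s. a * s - s ^ 3)" by (intro continuous_intros)
  \<comment> \<open>The same level on the decreasing branch between \<open>m\<close> and
    \<open>sqrt a\<close>; \<open>r > m\<close> keeps the derivative away from 0. The constant
    \<open>- 2 * a\<close> used next is the derivative at \<open>sqrt a\<close>, its least value on
    the interval.\<close>
  then obtain r where r: "m \<le> r" "r \<le> s" "a * r - r ^ 3 = h t0"
    using IVT2'[of "\<lambda>s. a * s - s ^ 3" s "h t0" m] h(3,4)[of t0] ms fm fs by auto
  have "r \<noteq> m" using r(3) h(4)[of t0] fm by auto
  then have rm: "m < r" using r(1) by simp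
  then have r2: "a < 3 * r\<^sup>2" unfolding a(1) using a(2) by (simp add: power_strict_mono)
  obtain x where x: "periodic_solution T c a h x" "\<And>t. r \<le> x t"
  proof (rule duffing_solution_between[OF h(1,2) T c _ _ r(2), of "- 2 * a" "(3 * a - 3 * r\<^sup>2) / (2 * a)" a])
    show "- 2 * a \<noteq> 0" using a0 by simp
    have "- 2 * a < 0" using a0 by simp
    also have "0 < (pi / T)\<^sup>2 + c\<^sup>2 / 4" using T c by (intro add_pos_pos) auto
    finally show "- 2 * a < (pi / T)\<^sup>2 + c\<^sup>2 / 4" .
    show "(3 * a - 3 * r\<^sup>2) / (2 * a) < 1" using a0 r2 by simp
    fix w assume w: "r \<le> w" "w \<le> s"
    have "r\<^sup>2 \<le> w\<^sup>2" using w a(2) r(1) by (intro power_mono) auto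
    moreover have "w\<^sup>2 \<le> a" unfolding s(2) using w a(2) r(1) by (intro power_mono) auto
    moreover have "1 - (a - 3 * w\<^sup>2) / (- 2 * a) = (3 * a - 3 * w\<^sup>2) / (2 * a)"
      using a0 by (simp add: field_simps)
    ultimately show "0 \<le> 1 - (a - 3 * w\<^sup>2) / (- 2 * a) \<and>
        1 - (a - 3 * w\<^sup>2) / (- 2 * a) \<le> (3 * a - 3 * r\<^sup>2) / (2 * a)"
      using a0 by (auto intro!: divide_right_mono divide_nonneg_pos)
  next
    fix t
    have "0 \<le> a * r - r ^ 3 - h t" using r(3) H[of t] by simp
    then show "(a * r - r ^ 3 - h t) / (- 2 * a) \<le> 0" using a0 by (intro divide_nonneg_neg) auto
    have "a * s - s ^ 3 - h t \<le> 0" using fs h(3)[of t] by simp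
    then show "0 \<le> (a * s - s ^ 3 - h t) / (- 2 * a)" using a0 by (intro divide_nonpos_neg) auto
  qed (rule that)
  have "m < x t" for t using x(2)[of t] rm by linarith
  then show thesis using that x(1) by blast
qed

section \<open>Sign, forcing level and instability of Duffing solutions\<close>

lemma duffing_solution_sign:
  assumes x: "periodic_solution T c a h x" and T: "T > 0" and a: "a < (pi / T)\<^sup>2 + c\<^sup>2 / 4"
    and h: "\<And>t. h t > 0"
  shows "(\<forall>t. x t > 0) \<or> (\<forall>t. x t < 0)"
proof -
  obtain y where y: "damped c (\<lambda>t. a - (x t)\<^sup>2) h x y" "\<forall>t. x (t + T) = x t"
    using periodic_solution_damped[OF x] .
  have "a - (x t)\<^sup>2 < (pi / T)\<^sup>2 + c\<^sup>2 / 4" for t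
    using a zero_le_power2[of "x t"] by linarith
  then show ?thesis by (rule damped_periodic_sign[OF y(1) h _ y(2) T])
qed

text \<open>At the maximum of \<open>x\<close> the forcing is at most \<open>a x - x^3\<close>,
  which for positive \<open>x\<close> never exceeds its value \<open>2 * m ^ 3\<close> at
  \<open>m\<close>; the gap is \<open>(x - m)\<^sup>2 * (x + 2 * m)\<close>.\<close>

lemma duffing_positive_solution_forcing:
  assumes x: "periodic_solution T c a h x" "\<And>t. x t > 0" and T: "T > 0" and a: "a = 3 * m\<^sup>2" "m > 0"
  obtains t where "h t \<le> 2 * m ^ 3"
proof -
  obtain y where y: "damped c (\<lambda>t. a - (x t)\<^sup>2) h x y" "\<forall>t. x (t + T) = x t"
    using periodic_solution_damped[OF x(1)] .
  obtain t where t: "h t \<le> (a - (x t)\<^sup>2) * x t" using damped_at_max[OF y T] by blast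
  have "0 \<le> (x t - m)\<^sup>2 * (x t + 2 * m)" using x(2)[of t] a(2) by (intro mult_nonneg_nonneg) auto
  also have "\<dots> = 2 * m ^ 3 - (a - (x t)\<^sup>2) * x t"
    by (simp add: a(1) power2_eq_square power3_eq_cube algebra_simps)
  finally have "h t \<le> 2 * m ^ 3" using t by simp
  then show thesis by (rule that)
qed

lemma unstable_if_beyond_inflection:
  assumes x: "periodic_solution T c a h x" and T: "T > 0" and m: "a = 3 * m\<^sup>2" "m > 0"
    and beyond: "\<And>t. m < \<bar>x t\<bar>"
  shows "unstable T c a x"
proof -
  obtain y where y: "damped c (\<lambda>t. a - (x t)\<^sup>2) h x y" "\<forall>t. x (t + T) = x t"
    using periodic_solution_damped[OF x] .
  have "m\<^sup>2 < \<bar>x t\<bar>\<^sup>2" for t using beyond[of t] m(2) by (intro power_strict_mono) auto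
  then have "a < 3 * (x t)\<^sup>2" for t by (simp add: m(1))
  then show ?thesis by (rule unstable_if_potential_negative[OF damped_continuous(1)[OF y(1)] y(2) T])
qed

lemma unstable_if_negative:
  assumes x: "periodic_solution T c a h x" "\<And>t. x t < 0" and T: "T > 0" and m: "a = 3 * m\<^sup>2" "m > 0"
    and h: "\<And>t. h t > 0"
  shows "unstable T c a x"
proof (rule unstable_if_beyond_inflection[OF x(1) T m])
  fix t
  have a0: "a > 0" using m by simp
  have "m\<^sup>2 < a" using m by simp
  then have "m < sqrt a" by (rule real_less_rsqrt)
  then show "m < \<bar>x t\<bar>" using negative_solution_bound[OF x(1) T a0 h x(2), of t] by linarith
qed

theorem theorem1p1:
  fixes T c a :: real and h :: "real \<Rightarrow> real"
  assumes "T > 0" and "c > 0" and "a > 0"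
    and "a < (pi / T)^2 + c^2 / 4"
    and "continuous_on UNIV h"
    and "\<forall>t. h t > 0"
    and "\<forall>t. h (t + T) = h t"
  defines "h0 \<equiv> sqrt (4 * a^3 / 27)"
  shows "((\<forall>t. h t > h0) \<longrightarrow>
            (\<exists>x. {x. periodic_solution T c a h x} = {x} \<and>
                 (\<forall>t. x t < 0) \<and> unstable T c a x))
       \<and> ((\<forall>t. 0 < h t \<and> h t < h0) \<longrightarrow>
            (\<exists>x1 x2 x3. {x. periodic_solution T c a h x} = {x1, x2, x3} \<and>
                 (\<forall>t. x1 t < x2 t \<and> x2 t < x3 t) \<and>
                 (\<forall>t. x1 t < 0 \<and> x2 t > 0 \<and> x3 t > 0) \<and>
                 asympt_stable T c a x2 \<and> unstable T c a x1 \<and> unstable T c a x3))"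
proof -
  define m where "m = sqrt (a / 3)"
  have m: "a = 3 * m\<^sup>2" "m > 0" using \<open>a > 0\<close> by (auto simp: m_def)
  have "4 * a ^ 3 / 27 = (2 * m ^ 3)\<^sup>2" unfolding m(1) by (simp add: power2_eq_square power3_eq_cube)
  then have h0: "h0 = 2 * m ^ 3" using m(2) unfolding h0_def by (simp only: real_sqrt_abs) simp
  have hpos: "\<And>t. h t > 0" using assms(6) by simp
  obtain x1 where x1: "periodic_solution T c a h x1" "\<And>t. x1 t < 0"
    using duffing_negative_solution_exists[OF assms(1-3,5,7) hpos] by blast
  have x1_unstable: "unstable T c a x1" by (rule unstable_if_negative[OF x1 assms(1) m hpos])
  have cases: "x = x1 \<or> (\<forall>t. x t > 0)" if "periodic_solution T c a h x" for x
    using duffing_solution_sign[OF that assms(1,4) hpos]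
      negative_solution_unique[OF that _ x1 assms(1,3,4) hpos] by blast
  show ?thesis
  proof (intro conjI impI)
    assume large: "\<forall>t. h t > h0"
    have "x = x1" if x: "periodic_solution T c a h x" for x
    proof (rule ccontr)
      assume "x \<noteq> x1"
      then have "\<And>t. x t > 0" using cases[OF x] by blast
      then obtain t where "h t \<le> 2 * m ^ 3"
        using duffing_positive_solution_forcing[OF x _ assms(1) m] by blast
      then show False using large h0 by (meson not_le)
    qed
    then have "{x. periodic_solution T c a h x} = {x1}" using x1(1) by blast
    then show "\<exists>x. {x. periodic_solution T c a h x} = {x} \<and> (\<forall>t. x t < 0) \<and> unstable T c a x"
      using x1(2) x1_unstable by blast
  next
    assume "\<forall>t. 0 < h t \<and> h t < h0"
    then have small: "\<And>t. h t < 2 * m ^ 3" by (simp add: h0)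
    obtain x2 where x2: "periodic_solution T c a h x2" "\<And>t. 0 \<le> x2 t" "\<And>t. x2 t < m"
      using duffing_middle_solution_exists[OF assms(1,2) m assms(4,5,7) hpos small] by blast
    obtain x3 where x3: "periodic_solution T c a h x3" "\<And>t. m < x3 t"
      using duffing_upper_solution_exists[OF assms(1,2) m assms(5,7) hpos small] by blast
    \<comment> \<open>The construction gives only \<open>0 \<le> x2\<close>; the strict sign
      dichotomy excludes zeros.\<close>
    have x2_pos: "x2 t > 0" for t
      using duffing_solution_sign[OF x2(1) assms(1,4) hpos] x2(2) by (meson not_le)
    have x23: "x2 t < x3 t" for t using x2(3)[of t] x3(2)[of t] by linarith
    have "x = x1 \<or> x = x2 \<or> x = x3" if x: "periodic_solution T c a h x" for x
    proof (rule ccontr)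
      assume "\<not> ?thesis"
      then have ne: "x \<noteq> x2" "x \<noteq> x3" and pos: "\<And>t. x t > 0" using cases[OF x] by auto
      note no3 = no_three_positive_solutions[OF _ _ _ assms(1)]
      have "(\<forall>t. x t < x2 t) \<or> (\<forall>t. x2 t < x t)" "(\<forall>t. x t < x3 t) \<or> (\<forall>t. x3 t < x t)"
        using periodic_solutions_ordered[OF x _ _ assms(1,4)] x2(1) x3(1) ne by blast+
      \<comment> \<open>A further positive solution would lie below \<open>x2\<close>, between
        \<open>x2\<close> and \<open>x3\<close>, or above \<open>x3\<close>; each position yields
        three ordered positive solutions.\<close>
      then show False
        using no3[OF x x2(1) x3(1) pos _ x23] no3[OF x2(1) x x3(1) x2_pos]
          no3[OF x2(1) x3(1) x x2_pos x23] by blast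
    qed
    then have all: "{x. periodic_solution T c a h x} = {x1, x2, x3}" using x1(1) x2(1) x3(1) by blast
    have "unstable T c a x3"
      by (rule unstable_if_beyond_inflection[OF x3(1) assms(1) m]) (rule less_le_trans[OF x3(2) abs_ge_self])
    moreover have "asympt_stable T c a x2"
    proof -
      obtain y where y: "damped c (\<lambda>t. a - (x2 t)\<^sup>2) h x2 y" "\<forall>t. x2 (t + T) = x2 t"
        using periodic_solution_damped[OF x2(1)] .
      have "3 * (x2 t)\<^sup>2 < a" for t
        unfolding m(1) using power_strict_mono[OF x2(3) x2(2), of 2 t] by simp
      then show ?thesis
        by (rule asympt_stable_if_potential_positive[OF damped_continuous(1)[OF y(1)] y(2) assms(1,2,4)])
    qed
    moreover have "x1 t < x2 t \<and> x2 t < x3 t" "x1 t < 0 \<and> x2 t > 0 \<and> x3 t > 0" for t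
      using x1(2)[of t] x2_pos[of t] x23[of t] by linarith+
    ultimately show "\<exists>x1 x2 x3. {x. periodic_solution T c a h x} = {x1, x2, x3} \<and>
                 (\<forall>t. x1 t < x2 t \<and> x2 t < x3 t) \<and>
                 (\<forall>t. x1 t < 0 \<and> x2 t > 0 \<and> x3 t > 0) \<and>
                 asympt_stable T c a x2 \<and> unstable T c a x1 \<and> unstable T c a x3"
      using all x1_unstable by blast
  qed
qed

end
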